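(* Let $V$ be a finite-dimensional complex vector space with Lie brackets $[\,,]$ and $\{\,,\}$, $\mathfrak{g}=(V,[\,,])$, $\mathfrak{n}=(V,\{\,,\})$, where $\mathfrak{n}$ is semisimple and not isomorphic to a direct sum of copies of $\mathfrak{sl}_2(\mathbb{C})$. Suppose that for some $z\in\mathfrak{n}$ and $\lambda\in\mathbb{C}$ the product $x\cdot y=\{\{z,x\},y\}+\lambda\{x,y\}$ is a post-Lie algebra structure on $(\mathfrak{g},\mathfrak{n})$. Then either $x\cdot y=0$ and $[x,y]=\{x,y\}$ for all $x,y\in V$, or $x\cdot y=-\{x,y\}$ and $[x,y]=-\{x,y\}$ for all $x,y\in V$.
   Context: A post-Lie algebra structure on $(\mathfrak{g},\mathfrak{n})$ is a bilinear product $x\cdot y$ on $V$ satisfying, for all $x,y,z\in V$: (1) $x\cdot y-y\cdot x=[x,y]-\{x,y\}$; (2) $[x,y]\cdot z=x\cdot(y\cdot z)-y\cdot(x\cdot z)$; (3) $x\cdot\{y,z\}=\{x\cdot y,z\}+\{y,x\cdot z\}$. *)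

theory Defs
  imports "HOL-Analysis.Analysis"
begin

definition fin_dim_cvs :: "(complex \<Rightarrow> 'v::ab_group_add \<Rightarrow> 'v) \<Rightarrow> bool" where
  "fin_dim_cvs smul \<longleftrightarrow> vector_space smul \<and>
     (\<exists>B. finite B \<and> module.span smul B = UNIV)"

definition bilinear_map :: "(complex \<Rightarrow> 'v::ab_group_add \<Rightarrow> 'v) \<Rightarrow> ('v \<Rightarrow> 'v \<Rightarrow> 'v) \<Rightarrow> bool" where
  "bilinear_map smul br \<longleftrightarrow>
     (\<forall>x. Vector_Spaces.linear smul smul (br x)) \<and>
     (\<forall>y. Vector_Spaces.linear smul smul (\<lambda>x. br x y))"

definition lie_algebra :: "(complex \<Rightarrow> 'v::ab_group_add \<Rightarrow> 'v) \<Rightarrow> ('v \<Rightarrow> 'v \<Rightarrow> 'v) \<Rightarrow> bool" where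
  "lie_algebra smul br \<longleftrightarrow> vector_space smul \<and> bilinear_map smul br \<and>
     (\<forall>x. br x x = 0) \<and>
     (\<forall>x y z. br x (br y z) + br y (br z x) + br z (br x y) = 0)"

definition lie_ideal :: "(complex \<Rightarrow> 'v::ab_group_add \<Rightarrow> 'v) \<Rightarrow> ('v \<Rightarrow> 'v \<Rightarrow> 'v) \<Rightarrow> 'v set \<Rightarrow> bool" where
  "lie_ideal smul br I \<longleftrightarrow> module.subspace smul I \<and> (\<forall>x y. y \<in> I \<longrightarrow> br x y \<in> I)"

fun derived_series :: "(complex \<Rightarrow> 'v::ab_group_add \<Rightarrow> 'v) \<Rightarrow> ('v \<Rightarrow> 'v \<Rightarrow> 'v) \<Rightarrow> 'v set \<Rightarrow> nat \<Rightarrow> 'v set" where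
  "derived_series smul br I 0 = I"
| "derived_series smul br I (Suc n) =
     module.span smul {br a b | a b. a \<in> derived_series smul br I n \<and> b \<in> derived_series smul br I n}"

definition solvable_ideal :: "(complex \<Rightarrow> 'v::ab_group_add \<Rightarrow> 'v) \<Rightarrow> ('v \<Rightarrow> 'v \<Rightarrow> 'v) \<Rightarrow> 'v set \<Rightarrow> bool" where
  "solvable_ideal smul br I \<longleftrightarrow> (\<exists>n. derived_series smul br I n = {0})"

definition semisimple :: "(complex \<Rightarrow> 'v::ab_group_add \<Rightarrow> 'v) \<Rightarrow> ('v \<Rightarrow> 'v \<Rightarrow> 'v) \<Rightarrow> bool" where
  "semisimple smul br \<longleftrightarrow> lie_algebra smul br \<and>
     (\<forall>I. lie_ideal smul br I \<and> solvable_ideal smul br I \<longrightarrow> I = {0})"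

definition sl2 :: "(complex^2^2) set" where
  "sl2 = {A. trace A = 0}"

definition comm :: "complex^2^2 \<Rightarrow> complex^2^2 \<Rightarrow> complex^2^2" where
  "comm A B = A ** B - B ** A"

definition mscale :: "complex \<Rightarrow> complex^2^2 \<Rightarrow> complex^2^2" where
  "mscale c A = (\<chi> i j. c * A $ i $ j)"

definition sl2_sum :: "nat \<Rightarrow> (nat \<Rightarrow> complex^2^2) set" where
  "sl2_sum k = {u. (\<forall>i<k. u i \<in> sl2) \<and> (\<forall>i\<ge>k. u i = 0)}"

definition iso_sum_sl2 :: "(complex \<Rightarrow> 'v::ab_group_add \<Rightarrow> 'v) \<Rightarrow> ('v \<Rightarrow> 'v \<Rightarrow> 'v) \<Rightarrow> bool" where
  "iso_sum_sl2 smul br \<longleftrightarrow> (\<exists>k \<phi>. bij_betw \<phi> UNIV (sl2_sum k) \<and>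
     (\<forall>x y. \<phi> (x + y) = (\<lambda>i. \<phi> x i + \<phi> y i)) \<and>
     (\<forall>c x. \<phi> (smul c x) = (\<lambda>i. mscale c (\<phi> x i))) \<and>
     (\<forall>x y. \<phi> (br x y) = (\<lambda>i. comm (\<phi> x i) (\<phi> y i))))"

text \<open>Post-Lie algebra structure on (g, n) = ((V, lb), (V, nb)).\<close>
definition post_lie :: "(complex \<Rightarrow> 'v::ab_group_add \<Rightarrow> 'v) \<Rightarrow> ('v \<Rightarrow> 'v \<Rightarrow> 'v) \<Rightarrow> ('v \<Rightarrow> 'v \<Rightarrow> 'v)
    \<Rightarrow> ('v \<Rightarrow> 'v \<Rightarrow> 'v) \<Rightarrow> bool" where
  "post_lie smul lb nb P \<longleftrightarrow> bilinear_map smul P \<and>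
     (\<forall>x y. P x y - P y x = lb x y - nb x y) \<and>
     (\<forall>x y z. P (lb x y) z = P x (P y z) - P y (P x z)) \<and>
     (\<forall>x y z. P x (nb y z) = nb (P x y) z + nb y (P x z))"

end

theory Submission
  imports Defs "HOL-Computational_Algebra.Fundamental_Theorem_Algebra"
begin

text \<open>
  Write \<open>D = ad z\<close>. Since \<open>n\<close> has trivial centre, the post-Lie axioms amount to
  \<open>{D x, D y} = p(D) {x, y}\<close> with \<open>p(D) = (D + \<lambda>)(D + \<lambda> + 1)\<close>, and \<open>x = z\<close> gives \<open>D p(D) = 0\<close>.
  If \<open>\<lambda>\<close> is not \<open>0\<close>, \<open>-1\<close> or \<open>-1/2\<close>, the image of \<open>D\<close> is an abelian ideal, so \<open>z = 0\<close> and then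
  \<open>n = 0\<close>. If \<open>\<lambda> = 0\<close>, the eigenspace of \<open>D\<close> for \<open>-1\<close> is an abelian ideal, hence \<open>D\<^sup>2 = 0\<close>, \<open>D\<close>
  kills \<open>{n, n}\<close>, and \<open>z = 0\<close>; the case \<open>\<lambda> = -1\<close> follows by replacing \<open>z\<close> with \<open>-z\<close>.
  If \<open>\<lambda> = -1/2\<close>, then \<open>ad (2z)\<close> is diagonalisable with eigenvalues \<open>1, 0, -1\<close>, and each of the
  eigenspaces \<open>P\<close>, \<open>Z\<close>, \<open>N\<close> is abelian. A common eigenvector \<open>e \<in> P\<close> of \<open>Z\<close> then extends to an
  \<open>sl2\<close>-triple \<open>(e, h, f)\<close> such that \<open>h\<close> has rank one on \<open>P\<close> and on \<open>N\<close>, which makes \<open>n\<close> the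
  direct sum of such triples.
\<close>

section \<open>Common eigenvectors of commuting operators\<close>

locale complex_fdvs = finite_dimensional_vector_space scale Basis
  for scale :: "complex \<Rightarrow> 'v::ab_group_add \<Rightarrow> 'v"  (infixr \<open>\<odot>\<close> 75) and Basis :: "'v set"
begin

text \<open>The vector \<open>p(T) v\<close>, computed by Horner's scheme along the coefficients of
  \<open>p\<close>.\<close>

definition poly_act :: "('v \<Rightarrow> 'v) \<Rightarrow> 'v \<Rightarrow> complex poly \<Rightarrow> 'v" where
  "poly_act T v p = fold_coeffs (\<lambda>a w. a \<odot> v + T w) p 0"

lemma poly_act_simps:
  assumes "Vector_Spaces.linear scale scale T"
  shows "poly_act T v 0 = 0" "poly_act T v (pCons a p) = a \<odot> v + T (poly_act T v p)"
proof -
  interpret T: Vector_Spaces.linear scale scale T by fact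
  show "poly_act T v 0 = 0" by (simp add: poly_act_def)
  show "poly_act T v (pCons a p) = a \<odot> v + T (poly_act T v p)"
    by (cases "p = 0 \<and> a = 0") (auto simp: poly_act_def)
qed

lemma poly_act_linear:
  assumes "Vector_Spaces.linear scale scale T"
  shows "poly_act T v (p + q) = poly_act T v p + poly_act T v q"
    and "poly_act T v (smult c p) = c \<odot> poly_act T v p"
    and "poly_act T v (monom c i) = c \<odot> (T ^^ i) v"
proof -
  interpret T: Vector_Spaces.linear scale scale T by fact
  note s = poly_act_simps[OF assms]
  show "poly_act T v (p + q) = poly_act T v p + poly_act T v q"
    by (induction p q rule: poly_induct2) (simp_all add: s T.add algebra_simps)
  show sm: "poly_act T v (smult c p) = c \<odot> poly_act T v p" for c p
    by (induction p) (simp_all add: s T.scale algebra_simps)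
  show "poly_act T v (monom c i) = c \<odot> (T ^^ i) v"
    by (induction i) (simp_all add: s monom_Suc monom_0 T.scale)
qed

lemma poly_act_sum:
  assumes "Vector_Spaces.linear scale scale T"
  shows "poly_act T v (sum f A) = (\<Sum>i\<in>A. poly_act T v (f i))"
  by (induction A rule: infinite_finite_induct)
    (simp_all add: poly_act_simps[OF assms] poly_act_linear[OF assms])

lemma poly_act_in:
  assumes "Vector_Spaces.linear scale scale T" "subspace W" "T ` W \<subseteq> W" "v \<in> W"
  shows "poly_act T v p \<in> W"
  using assms(2-) by (induction p)
    (auto simp: poly_act_simps[OF assms(1)] subspace_0 intro!: subspace_add subspace_scale)

text \<open>If the iterates of \<open>v\<close> are pairwise distinct, they form an infinite, hence
  dependent, set, and a dependence supplies the coefficients. If two of them coincide, a difference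
  of two monomials does.\<close>

lemma exists_annihilating_poly:
  assumes T: "Vector_Spaces.linear scale scale T"
  shows "\<exists>p. p \<noteq> 0 \<and> poly_act T v p = 0"
proof (cases "inj (\<lambda>i. (T ^^ i) v)")
  case True
  let ?f = "\<lambda>i. (T ^^ i) v"
  have "infinite (range ?f)" using True by (simp add: finite_image_iff)
  then have "dependent (range ?f)" using finiteI_independent by blast
  then obtain t u x where t: "finite t" "t \<subseteq> range ?f" "(\<Sum>v\<in>t. u v \<odot> v) = 0" "x \<in> t" "u x \<noteq> 0"
    unfolding dependent_explicit by blast
  define S where "S = ?f -` t"
  have fS: "finite S" unfolding S_def using t(1) True by (rule finite_vimageI)
  have tS: "t = ?f ` S" using t(2) by (auto simp: S_def)
  define p where "p = (\<Sum>i\<in>S. monom (u (?f i)) i)"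
  have "poly_act T v p = (\<Sum>i\<in>S. u (?f i) \<odot> ?f i)"
    by (simp add: p_def poly_act_sum[OF T] poly_act_linear[OF T])
  also have "\<dots> = (\<Sum>v\<in>t. u v \<odot> v)"
    unfolding tS by (subst sum.reindex) (auto intro: inj_on_subset[OF True])
  finally have "poly_act T v p = 0" using t by simp
  moreover obtain j where "j \<in> S" "x = ?f j" using t(4) tS by auto
  then have "coeff p j = u x"
    using fS by (simp add: p_def coeff_sum)
  then have "p \<noteq> 0" using t(5) by auto
  ultimately show ?thesis by blast
next
  case False
  then obtain i j where ij: "i \<noteq> j" "(T ^^ i) v = (T ^^ j) v" by (auto simp: inj_def)
  define p where "p = monom (1::complex) i + monom (-1) j"
  have "coeff p i = 1" using ij by (simp add: p_def)
  then have "p \<noteq> 0" by auto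
  moreover have "poly_act T v p = 0"
    by (simp add: p_def poly_act_linear[OF T] ij)
  ultimately show ?thesis by blast
qed

text \<open>Take \<open>p\<close> of least degree with \<open>p(T) v = 0\<close> for a nonzero
  \<open>v\<close> in \<open>W\<close>, and a root \<open>c\<close> of it. Writing
  \<open>p = (X - c) q\<close>, minimality makes \<open>q(T) v\<close> nonzero, and
  \<open>T - c\<close> kills it.\<close>

lemma exists_eigenvector:
  assumes T: "Vector_Spaces.linear scale scale T" and W: "subspace W" "T ` W \<subseteq> W" "W \<noteq> {0}"
  shows "\<exists>w\<in>W. w \<noteq> 0 \<and> (\<exists>c. T w = c \<odot> w)"
proof -
  obtain v where v: "v \<in> W" "v \<noteq> 0" using W subspace_0 by blast
  define n where "n = (LEAST n. \<exists>p. p \<noteq> 0 \<and> poly_act T v p = 0 \<and> degree p = n)"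
  have "\<exists>p. p \<noteq> 0 \<and> poly_act T v p = 0 \<and> degree p = n"
    unfolding n_def by (rule LeastI_ex) (use exists_annihilating_poly[OF T] in blast)
  then obtain p where p: "p \<noteq> 0" "poly_act T v p = 0" "degree p = n" by blast
  have "n \<noteq> 0"
  proof
    assume "n = 0"
    then obtain a where a: "p = [:a:]" using p(3) degree_eq_zeroE by blast
    interpret T: Vector_Spaces.linear scale scale T by fact
    show False using p(1,2) v by (simp add: a poly_act_simps[OF T])
  qed
  then have "\<not> constant (poly p)" using p(3) by (simp add: constant_degree)
  then obtain c where "poly p c = 0" using fundamental_theorem_of_algebra by blast
  then obtain q where q: "p = [:-c, 1:] * q" using poly_eq_0_iff_dvd dvdE by blast
  have "q \<noteq> 0" using p(1) q by auto
  then have "degree p = degree [:-c, 1:] + degree q" unfolding q by (intro degree_mult_eq) auto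
  then have "degree q < n" using p(3) by simp
  then have w0: "poly_act T v q \<noteq> 0"
    using not_less_Least[of "degree q"] \<open>q \<noteq> 0\<close> unfolding n_def by blast
  have "p = smult (-c) q + pCons 0 q" by (simp add: q)
  then have "poly_act T v p = (-c) \<odot> poly_act T v q + T (poly_act T v q)"
    by (simp only: poly_act_linear[OF T] poly_act_simps[OF T] scale_zero_left add_0_left)
  then have "T (poly_act T v q) = c \<odot> poly_act T v q"
    using p(2) by (simp add: add_eq_0_iff)
  with w0 poly_act_in[OF T W(1,2) v(1)] show ?thesis by blast
qed

text \<open>In a nonzero invariant subspace \<open>U\<close> of least dimension, an eigenspace of
  any \<open>T\<close> in \<open>F\<close> is again invariant, because the operators commute, so it
  is all of \<open>U\<close>. Every member of \<open>F\<close> is then scalar on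
  \<open>U\<close>.\<close>

lemma exists_common_eigenvector:
  assumes lin: "\<And>T. T \<in> F \<Longrightarrow> Vector_Spaces.linear scale scale T"
    and comm: "\<And>S T x. S \<in> F \<Longrightarrow> T \<in> F \<Longrightarrow> x \<in> W \<Longrightarrow> S (T x) = T (S x)"
    and W: "subspace W" "W \<noteq> {0}" and inv: "\<And>T. T \<in> F \<Longrightarrow> T ` W \<subseteq> W"
  shows "\<exists>w\<in>W. w \<noteq> 0 \<and> (\<forall>T\<in>F. \<exists>c. T w = c \<odot> w)"
proof -
  let ?P = "\<lambda>U. subspace U \<and> U \<noteq> {0} \<and> U \<subseteq> W \<and> (\<forall>T\<in>F. T ` U \<subseteq> U)"
  obtain U where U: "?P U" and min: "\<And>U'. ?P U' \<Longrightarrow> dim U \<le> dim U'"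
  proof -
    have "?P W" using W inv by simp
    from ex_has_least_nat[of ?P, OF this, of dim] show thesis using that by auto
  qed
  have scalar: "\<exists>c. \<forall>x\<in>U. T x = c \<odot> x" if T: "T \<in> F" for T
  proof -
    interpret T: Vector_Spaces.linear scale scale T by (rule lin[OF T])
    obtain w c where w: "w \<in> U" "w \<noteq> 0" "T w = c \<odot> w"
      using exists_eigenvector[OF lin[OF T], of U] U T by blast
    define U' where "U' = {x \<in> U. T x = c \<odot> x}"
    have "subspace U'"
      using U by (auto simp: U'_def subspace_def T.add T.scale algebra_simps)
    moreover have "U' \<noteq> {0}" using w by (auto simp: U'_def)
    moreover have "S ` U' \<subseteq> U'" if S: "S \<in> F" for S
    proof -
      interpret S: Vector_Spaces.linear scale scale S by (rule lin[OF S])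
      show ?thesis using comm[OF T S] U S by (auto simp: U'_def S.scale subset_iff)
    qed
    moreover have sub: "U' \<subseteq> U" by (auto simp: U'_def)
    ultimately have P': "?P U'" using U by (simp add: subset_trans)
    have "U' = U"
      by (rule subspace_dim_equal[OF conjunct1[OF P'] conjunct1[OF U] sub min[OF P']])
    then show ?thesis by (auto simp: U'_def)
  qed
  obtain w where "w \<in> U" "w \<noteq> 0" using U subspace_0 by blast
  then show ?thesis using scalar conjunct1[OF conjunct2[OF conjunct2[OF U]]] by blast
qed

end

section \<open>Lie algebras without abelian ideals\<close>

locale cfd_lie = complex_fdvs scale Basis
  for scale :: "complex \<Rightarrow> 'v::ab_group_add \<Rightarrow> 'v"  (infixr \<open>\<odot>\<close> 75) and Basis +
  fixes br :: "'v \<Rightarrow> 'v \<Rightarrow> 'v"  (\<open>\<lbrace>_, _\<rbrace>\<close>)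
  assumes bilinear: "bilinear_map scale br"
    and br_self [simp]: "\<lbrace>x, x\<rbrace> = 0"
    and jacobi: "\<lbrace>x, \<lbrace>y, w\<rbrace>\<rbrace> + \<lbrace>y, \<lbrace>w, x\<rbrace>\<rbrace> + \<lbrace>w, \<lbrace>x, y\<rbrace>\<rbrace> = 0"
begin

lemma br_linear: "Vector_Spaces.linear scale scale (br x)"
  "Vector_Spaces.linear scale scale (\<lambda>x. br x y)"
  using bilinear by (auto simp: bilinear_map_def)

lemmas br_right = br_linear(1)[unfolded module_hom_iff_linear[symmetric]]
lemmas br_left = br_linear(2)[unfolded module_hom_iff_linear[symmetric]]

lemma br_add_right: "\<lbrace>x, y + w\<rbrace> = \<lbrace>x, y\<rbrace> + \<lbrace>x, w\<rbrace>"
  and br_add_left: "\<lbrace>y + w, x\<rbrace> = \<lbrace>y, x\<rbrace> + \<lbrace>w, x\<rbrace>"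
  and br_scale_right: "\<lbrace>x, c \<odot> y\<rbrace> = c \<odot> \<lbrace>x, y\<rbrace>"
  and br_scale_left: "\<lbrace>c \<odot> y, x\<rbrace> = c \<odot> \<lbrace>y, x\<rbrace>"
  and br_diff_right: "\<lbrace>x, y - w\<rbrace> = \<lbrace>x, y\<rbrace> - \<lbrace>x, w\<rbrace>"
  and br_diff_left: "\<lbrace>y - w, x\<rbrace> = \<lbrace>y, x\<rbrace> - \<lbrace>w, x\<rbrace>"
  and br_minus_right: "\<lbrace>x, - y\<rbrace> = - \<lbrace>x, y\<rbrace>"
  and br_minus_left: "\<lbrace>- y, x\<rbrace> = - \<lbrace>y, x\<rbrace>"
  and br_zero_right [simp]: "\<lbrace>x, 0\<rbrace> = 0"
  and br_zero_left [simp]: "\<lbrace>0, x\<rbrace> = 0"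
  and br_sum_right: "\<lbrace>x, sum f A\<rbrace> = (\<Sum>i\<in>A. \<lbrace>x, f i\<rbrace>)"
  and br_sum_left: "\<lbrace>sum f A, x\<rbrace> = (\<Sum>i\<in>A. \<lbrace>f i, x\<rbrace>)"
  using module_hom.add[OF br_right[of x]] module_hom.add[OF br_left[of x]]
    module_hom.scale[OF br_right[of x]] module_hom.scale[OF br_left[of x]]
    module_hom.diff[OF br_right[of x]] module_hom.diff[OF br_left[of x]]
    module_hom.neg[OF br_right[of x]] module_hom.neg[OF br_left[of x]]
    module_hom.zero[OF br_right[of x]] module_hom.zero[OF br_left[of x]]
    module_hom.sum[OF br_right[of x]] module_hom.sum[OF br_left[of x]]
  by auto

lemmas br_simps = br_add_right br_add_left br_scale_right br_scale_left br_diff_right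
  br_diff_left br_minus_right br_minus_left

lemma br_anti: "\<lbrace>y, x\<rbrace> = - \<lbrace>x, y\<rbrace>"
proof -
  have "\<lbrace>x + y, x + y\<rbrace> = \<lbrace>x, y\<rbrace> + \<lbrace>y, x\<rbrace>"
    unfolding br_add_left br_add_right by simp
  then show ?thesis by (simp add: eq_neg_iff_add_eq_0 add.commute)
qed

lemma br_deriv: "\<lbrace>x, \<lbrace>y, w\<rbrace>\<rbrace> = \<lbrace>\<lbrace>x, y\<rbrace>, w\<rbrace> + \<lbrace>y, \<lbrace>x, w\<rbrace>\<rbrace>"
  using jacobi[of x y w] br_anti[of w x] br_anti[of w "\<lbrace>x, y\<rbrace>"]
  by (simp add: br_minus_right algebra_simps)

text \<open>Doubled terms become sums, the form in which \<open>algebra_simps\<close> can cancel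
  them.\<close>

lemma scale_two: "2 \<odot> x = x + x" "(c * 2) \<odot> x = c \<odot> x + c \<odot> x" "(2 * c) \<odot> x = c \<odot> x + c \<odot> x"
  using scale_left_distrib[of 1 1 x] scale_left_distrib[of c c x]
  by (simp_all add: mult.commute[of c 2])

end

text \<open>Semisimplicity enters the argument as the absence of nonzero abelian ideals;
  \<open>cfd_semisimpleI\<close> supplies this.\<close>

locale cfd_semisimple = cfd_lie scale Basis br
  for scale :: "complex \<Rightarrow> 'v::ab_group_add \<Rightarrow> 'v"  (infixr \<open>\<odot>\<close> 75) and Basis
    and br (\<open>\<lbrace>_, _\<rbrace>\<close>) +
  assumes abelian_ideal_trivial:
    "subspace I \<Longrightarrow> (\<And>x y. y \<in> I \<Longrightarrow> \<lbrace>x, y\<rbrace> \<in> I) \<Longrightarrow>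
      (\<And>x y. x \<in> I \<Longrightarrow> y \<in> I \<Longrightarrow> \<lbrace>x, y\<rbrace> = 0) \<Longrightarrow> I \<subseteq> {0}"
begin

lemma centre_trivial:
  assumes "\<And>y. \<lbrace>x, y\<rbrace> = 0"
  shows "x = 0"
proof -
  let ?I = "{x. \<forall>y. \<lbrace>x, y\<rbrace> = 0}"
  have "?I \<subseteq> {0}"
  proof (rule abelian_ideal_trivial)
    show "subspace ?I" by (auto simp: subspace_def br_simps)
    show "\<lbrace>u, v\<rbrace> \<in> ?I" if "v \<in> ?I" for u v
      using that br_anti[of u v] by auto
  qed auto
  with assms show ?thesis by auto
qed

lemma eqI_br:
  assumes "\<And>w. \<lbrace>x, w\<rbrace> = \<lbrace>y, w\<rbrace>"
  shows "x = y"
  using centre_trivial[of "x - y"] assms by (simp add: br_diff_left)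

text \<open>Put \<open>R = D + l\<close>, so that the product is \<open>{R x, y}\<close>.
  Antisymmetrising determines \<open>lb\<close>, and the action axiom says that
  \<open>R (lb x y)\<close> and \<open>{R x, R y}\<close> have the same adjoint; as the centre is
  trivial they are equal. Expanding \<open>R\<close> yields the identity.\<close>

lemma post_lie_identity:
  assumes "post_lie scale lb br (\<lambda>x y. \<lbrace>\<lbrace>z, x\<rbrace>, y\<rbrace> + l \<odot> \<lbrace>x, y\<rbrace>)"
  shows "\<lbrace>\<lbrace>z, x\<rbrace>, \<lbrace>z, y\<rbrace>\<rbrace> =
    \<lbrace>z, \<lbrace>z, \<lbrace>x, y\<rbrace>\<rbrace>\<rbrace> + (2 * l + 1) \<odot> \<lbrace>z, \<lbrace>x, y\<rbrace>\<rbrace> + (l * (l + 1)) \<odot> \<lbrace>x, y\<rbrace>"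
proof -
  define R where "R x = \<lbrace>z, x\<rbrace> + l \<odot> x" for x
  have P: "\<lbrace>\<lbrace>z, x\<rbrace>, y\<rbrace> + l \<odot> \<lbrace>x, y\<rbrace> = \<lbrace>R x, y\<rbrace>" for x y
    by (simp add: R_def br_simps)
  have "\<lbrace>R x, y\<rbrace> - \<lbrace>R y, x\<rbrace> = lb x y - \<lbrace>x, y\<rbrace>"
    and act: "\<And>w. \<lbrace>R (lb x y), w\<rbrace> = \<lbrace>R x, \<lbrace>R y, w\<rbrace>\<rbrace> - \<lbrace>R y, \<lbrace>R x, w\<rbrace>\<rbrace>"
    using assms unfolding post_lie_def P by (blast, metis)
  then have "lb x y = \<lbrace>R x, y\<rbrace> - \<lbrace>R y, x\<rbrace> + \<lbrace>x, y\<rbrace>" by (simp add: algebra_simps)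
  also have "\<dots> = \<lbrace>z, \<lbrace>x, y\<rbrace>\<rbrace> + (2 * l + 1) \<odot> \<lbrace>x, y\<rbrace>"
    using br_deriv[of z x y] br_anti[of x "\<lbrace>z, y\<rbrace>"] br_anti[of x y]
    by (simp add: R_def br_simps algebra_simps scale_two)
  finally have lb: "lb x y = \<dots>" .
  have "R (lb x y) = \<lbrace>R x, R y\<rbrace>"
    by (rule eqI_br) (simp add: act br_deriv[of "R x" "R y"])
  then show ?thesis unfolding lb using br_deriv[of z x y]
    by (simp add: R_def br_simps algebra_simps scale_two)
qed

text \<open>The ideal \<open>C\<close> of all elements commuting with \<open>[V, V]\<close> meets \<open>[V, V]\<close> in an abelian ideal,
  so \<open>[C, V] = 0\<close>.\<close>

lemma centraliser_of_derived_trivial: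
  assumes "\<And>x y. \<lbrace>z, \<lbrace>x, y\<rbrace>\<rbrace> = 0"
  shows "z = 0"
proof -
  let ?C = "{c. \<forall>x y. \<lbrace>c, \<lbrace>x, y\<rbrace>\<rbrace> = 0}"
  let ?D = "span {\<lbrace>x, y\<rbrace> | x y. True}"
  have C: "subspace ?C" by (auto simp: subspace_def br_simps)
  have Cid: "\<lbrace>u, v\<rbrace> \<in> ?C" if "v \<in> ?C" for u v
  proof -
    have "\<lbrace>\<lbrace>u, v\<rbrace>, \<lbrace>x, y\<rbrace>\<rbrace> = 0" for x y
      using br_deriv[of u v "\<lbrace>x, y\<rbrace>"] that by simp
    then show ?thesis by simp
  qed
  have D: "\<lbrace>u, v\<rbrace> \<in> ?D" for u v by (rule span_base) blast
  have CD: "\<lbrace>c, d\<rbrace> = 0" if "c \<in> ?C" "d \<in> ?D" for c d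
    using that(2,1) by (induction rule: span_induct) (auto simp: subspace_def br_simps)
  have "?C \<inter> ?D \<subseteq> {0}"
  proof (rule abelian_ideal_trivial)
    show "subspace (?C \<inter> ?D)" using C by (intro subspace_inter) auto
    show "\<lbrace>u, v\<rbrace> \<in> ?C \<inter> ?D" if "v \<in> ?C \<inter> ?D" for u v
      using that by (intro IntI Cid D) simp
    show "\<lbrace>u, v\<rbrace> = 0" if "u \<in> ?C \<inter> ?D" "v \<in> ?C \<inter> ?D" for u v
      using CD that by blast
  qed
  then have trivial: "c = 0" if "c \<in> ?C" "c \<in> ?D" for c
    using that by (meson IntI singletonD subsetD)
  have "\<lbrace>z, y\<rbrace> = 0" for y
  proof -
    have "\<lbrace>y, z\<rbrace> \<in> ?C" using assms by (intro Cid) simp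
    then have "\<lbrace>z, y\<rbrace> \<in> ?C" unfolding br_anti[of z y] by (rule subspace_neg[OF C])
    then show ?thesis using D by (rule trivial)
  qed
  then show ?thesis by (rule centre_trivial)
qed

end

section \<open>The equation for \<open>ad z\<close> and the values of \<open>l\<close> that it
  allows\<close>

context cfd_semisimple
begin

context
  fixes z :: 'v and l :: complex
  assumes identity: "\<And>x y. \<lbrace>\<lbrace>z, x\<rbrace>, \<lbrace>z, y\<rbrace>\<rbrace> =
    \<lbrace>z, \<lbrace>z, \<lbrace>x, y\<rbrace>\<rbrace>\<rbrace> + (2 * l + 1) \<odot> \<lbrace>z, \<lbrace>x, y\<rbrace>\<rbrace> + (l * (l + 1)) \<odot> \<lbrace>x, y\<rbrace>"
begin

text \<open>The case \<open>x = z\<close> of \<open>identity\<close>, where the left side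
  vanishes.\<close>

lemma ad_cubic:
  "\<lbrace>z, \<lbrace>z, \<lbrace>z, x\<rbrace>\<rbrace>\<rbrace> = - ((2 * l + 1) \<odot> \<lbrace>z, \<lbrace>z, x\<rbrace>\<rbrace>) - (l * (l + 1)) \<odot> \<lbrace>z, x\<rbrace>"
proof -
  have "0 = \<lbrace>z, \<lbrace>z, \<lbrace>z, x\<rbrace>\<rbrace>\<rbrace> + (2 * l + 1) \<odot> \<lbrace>z, \<lbrace>z, x\<rbrace>\<rbrace> + (l * (l + 1)) \<odot> \<lbrace>z, x\<rbrace>"
    using identity[of z x] by simp
  then show ?thesis
    by (metis (no_types, lifting) add_eq_0_iff2 diff_conv_add_uminus minus_add_distrib add.assoc)
qed

text \<open>Apply \<open>D\<close> to \<open>identity\<close>: the right side becomes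
  \<open>D p(D) {x, y}\<close>, which is zero by \<open>ad_cubic\<close>, and the left side splits
  by the Leibniz rule.\<close>

lemma ad_skew: "\<lbrace>\<lbrace>z, \<lbrace>z, x\<rbrace>\<rbrace>, \<lbrace>z, y\<rbrace>\<rbrace> = - \<lbrace>\<lbrace>z, x\<rbrace>, \<lbrace>z, \<lbrace>z, y\<rbrace>\<rbrace>\<rbrace>"
proof -
  have "\<lbrace>z, \<lbrace>\<lbrace>z, x\<rbrace>, \<lbrace>z, y\<rbrace>\<rbrace>\<rbrace> = 0"
    by (subst identity) (simp add: br_simps ad_cubic)
  then show ?thesis
    by (simp only: br_deriv[of z "\<lbrace>z, x\<rbrace>"] eq_neg_iff_add_eq_0)
qed

text \<open>The skewness of \<open>D = br z\<close> on its image gives \<open>{D\<^sup>3 x, D y} = {D x, D\<^sup>3 y}\<close>; reducing \<open>D\<^sup>3\<close> by the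
  cubic relation leaves a nonzero multiple of the bracket in question.\<close>

lemma ad_square_ad_trivial:
  assumes "2 * l + 1 \<noteq> 0"
  shows "\<lbrace>\<lbrace>z, \<lbrace>z, x\<rbrace>\<rbrace>, \<lbrace>z, y\<rbrace>\<rbrace> = 0"
proof -
  let ?A = "\<lbrace>\<lbrace>z, \<lbrace>z, x\<rbrace>\<rbrace>, \<lbrace>z, y\<rbrace>\<rbrace>"
  have "\<lbrace>\<lbrace>z, \<lbrace>z, \<lbrace>z, x\<rbrace>\<rbrace>\<rbrace>, \<lbrace>z, y\<rbrace>\<rbrace> = \<lbrace>\<lbrace>z, x\<rbrace>, \<lbrace>z, \<lbrace>z, \<lbrace>z, y\<rbrace>\<rbrace>\<rbrace>\<rbrace>"
    using ad_skew[of "\<lbrace>z, x\<rbrace>" y] ad_skew[of x "\<lbrace>z, y\<rbrace>"] by simp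
  then have "(2 * l + 1) \<odot> ?A = - ((2 * l + 1) \<odot> ?A)"
    unfolding ad_cubic br_simps by (simp add: ad_skew[of x y])
  then have "(2 * (2 * l + 1)) \<odot> ?A = 0"
    by (simp only: scale_two eq_neg_iff_add_eq_0)
  then have "2 * (2 * l + 1) = 0 \<or> ?A = 0" by (simp only: scale_eq_0_iff)
  then show ?thesis using assms by (simp only: mult_eq_0_iff) simp
qed

text \<open>The constant \<open>?m\<close> is invertible here. Solving the cubic relation for its
  \<open>?m\<close> term shows first that the image of \<open>D\<close> is abelian, then that it is
  an ideal. Hence \<open>D = 0\<close>, and \<open>identity\<close> leaves
  \<open>?m {x, y} = 0\<close>.\<close>

lemma degenerate_if_generic_weight:
  assumes "2 * l + 1 \<noteq> 0" "l \<noteq> 0" "l + 1 \<noteq> 0"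
  shows "(x::'v) = 0"
proof -
  let ?m = "l * (l + 1)"
  have m: "?m \<noteq> 0" using assms by simp
  have abelian: "\<lbrace>\<lbrace>z, x\<rbrace>, \<lbrace>z, y\<rbrace>\<rbrace> = 0" for x y
  proof -
    have "\<lbrace>\<lbrace>z, \<lbrace>z, \<lbrace>z, x\<rbrace>\<rbrace>\<rbrace>, \<lbrace>z, y\<rbrace>\<rbrace> = 0"
      by (rule ad_square_ad_trivial[OF assms(1)])
    then show ?thesis using m
      unfolding ad_cubic br_simps ad_square_ad_trivial[OF assms(1)] by simp
  qed
  have "range (br z) \<subseteq> {0}"
  proof (rule abelian_ideal_trivial)
    show "subspace (range (br z))"
      using module_hom.subspace_image[OF br_right subspace_UNIV] .
    show "\<lbrace>u, v\<rbrace> = 0" if "u \<in> range (br z)" "v \<in> range (br z)" for u v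
      using that abelian by auto
    show "\<lbrace>u, v\<rbrace> \<in> range (br z)" if v: "v \<in> range (br z)" for u v
    proof -
      obtain y where y: "v = \<lbrace>z, y\<rbrace>" using v by blast
      let ?t = "\<lbrace>u, \<lbrace>z, y\<rbrace>\<rbrace>"
      \<comment> \<open>The other Leibniz term is \<open>{D u, D y}\<close>, a bracket inside the
        abelian image.\<close>
      have D: "\<lbrace>z, \<lbrace>u, \<lbrace>z, y\<rbrace>\<rbrace>\<rbrace> = \<lbrace>u, \<lbrace>z, \<lbrace>z, y\<rbrace>\<rbrace>\<rbrace>" for y
        by (simp add: br_deriv[of z u] abelian)
      have a: "\<lbrace>z, \<lbrace>z, ?t\<rbrace>\<rbrace> = - ((2 * l + 1) \<odot> \<lbrace>z, ?t\<rbrace>) - ?m \<odot> ?t"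
        unfolding D by (simp add: ad_cubic br_simps)
      \<comment> \<open>The cubic relation exhibits \<open>?m\<close> times \<open>?t\<close> as a
        value of \<open>D\<close>.\<close>
      have "\<lbrace>z, - \<lbrace>z, ?t\<rbrace> - (2 * l + 1) \<odot> ?t\<rbrace> = ?m \<odot> ?t"
        unfolding br_diff_right br_minus_right br_scale_right a by simp
      then have "\<lbrace>z, (1 / ?m) \<odot> (- \<lbrace>z, ?t\<rbrace> - (2 * l + 1) \<odot> ?t)\<rbrace> = ?t"
        using m unfolding br_scale_right by simp
      then show ?thesis unfolding y by (metis rangeI)
    qed
  qed
  then have "\<lbrace>z, y\<rbrace> = 0" for y by blast
  then have "?m \<odot> \<lbrace>x, y\<rbrace> = 0" for x y using identity[of x y] by simp
  then have "\<lbrace>x, y\<rbrace> = 0" for x y using m by simp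
  then show ?thesis by (rule centre_trivial)
qed

lemma ad_trivial_if_weight_zero:
  assumes "l = 0"
  shows "z = 0"
proof -
  have l: "2 * l + 1 \<noteq> 0" using assms by simp
  have cubic: "\<lbrace>z, \<lbrace>z, \<lbrace>z, x\<rbrace>\<rbrace>\<rbrace> = - \<lbrace>z, \<lbrace>z, x\<rbrace>\<rbrace>" for x
    using ad_cubic[of x] assms by simp
  let ?I = "{w. \<lbrace>z, w\<rbrace> = - w}"
  have "?I \<subseteq> {0}"
  proof (rule abelian_ideal_trivial)
    show "subspace ?I" by (auto simp: subspace_def br_simps)
    show "\<lbrace>u, v\<rbrace> = 0" if "u \<in> ?I" "v \<in> ?I" for u v
      using ad_square_ad_trivial[OF l, of u v] that by (simp add: br_simps)
    show "\<lbrace>u, w\<rbrace> \<in> ?I" if "w \<in> ?I" for u w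
    proof -
      let ?t = "\<lbrace>u, w\<rbrace>"
      have w: "\<lbrace>z, w\<rbrace> = - w" using that by simp
      have D: "\<lbrace>z, \<lbrace>u, w\<rbrace>\<rbrace> = \<lbrace>\<lbrace>z, u\<rbrace>, w\<rbrace> - \<lbrace>u, w\<rbrace>" for u
        by (simp add: br_deriv[of z u] w br_simps)
      have 0: "\<lbrace>\<lbrace>z, \<lbrace>z, u\<rbrace>\<rbrace>, w\<rbrace> = 0"
        using ad_square_ad_trivial[OF l, of u w] by (simp add: w br_simps)
      \<comment> \<open>Since \<open>{D\<^sup>2 u, w} = 0\<close>, the operator
        \<open>(D + 1)\<^sup>2\<close> kills \<open>?t\<close>. So does
        \<open>D\<^sup>2 (D + 1)\<close>, by the cubic relation, and the greatest common divisor of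
        the two polynomials is \<open>D + 1\<close>; the lines below carry out this
        elimination.\<close>
      have a: "\<lbrace>z, \<lbrace>z, ?t\<rbrace>\<rbrace> = - \<lbrace>z, ?t\<rbrace> - \<lbrace>z, ?t\<rbrace> - ?t"
        using 0 by (simp add: D br_simps)
      have "\<lbrace>z, \<lbrace>z, \<lbrace>z, ?t\<rbrace>\<rbrace>\<rbrace> = \<lbrace>z, - \<lbrace>z, ?t\<rbrace> - \<lbrace>z, ?t\<rbrace> - ?t\<rbrace>"
        unfolding a ..
      then have "- \<lbrace>z, \<lbrace>z, ?t\<rbrace>\<rbrace> = - \<lbrace>z, \<lbrace>z, ?t\<rbrace>\<rbrace> - \<lbrace>z, \<lbrace>z, ?t\<rbrace>\<rbrace> - \<lbrace>z, ?t\<rbrace>"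
        unfolding cubic br_simps .
      then have b: "\<lbrace>z, \<lbrace>z, ?t\<rbrace>\<rbrace> = - \<lbrace>z, ?t\<rbrace>" by (simp add: algebra_simps eq_neg_iff_add_eq_0)
      show ?thesis using a unfolding b by (simp add: algebra_simps eq_neg_iff_add_eq_0)
    qed
  qed
  \<comment> \<open>By \<open>cubic\<close>, \<open>D\<^sup>2 x\<close> lies in the eigenspace
    \<open>?I\<close>.\<close>
  then have sq: "\<lbrace>z, \<lbrace>z, x\<rbrace>\<rbrace> = 0" for x using cubic[of x] by blast
  have "\<lbrace>z, \<lbrace>x, y\<rbrace>\<rbrace> = 0" for x y
  proof -
    have i: "\<lbrace>\<lbrace>z, x\<rbrace>, \<lbrace>z, y\<rbrace>\<rbrace> = \<lbrace>z, \<lbrace>x, y\<rbrace>\<rbrace>"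
      using identity[of x y] assms by (simp add: sq)
    \<comment> \<open>Applying \<open>D\<close> twice to \<open>{x, y}\<close> leaves
      \<open>2 {D x, D y}\<close>, because \<open>D\<^sup>2 = 0\<close>; by \<open>i\<close> this is
      \<open>2 D {x, y}\<close>.\<close>
    have "0 = \<lbrace>z, \<lbrace>\<lbrace>z, x\<rbrace>, y\<rbrace>\<rbrace> + \<lbrace>z, \<lbrace>x, \<lbrace>z, y\<rbrace>\<rbrace>\<rbrace>"
      using sq[of "\<lbrace>x, y\<rbrace>"] br_deriv[of z x y] by (simp add: br_simps)
    also have "\<dots> = 2 \<odot> \<lbrace>\<lbrace>z, x\<rbrace>, \<lbrace>z, y\<rbrace>\<rbrace>"
      using br_deriv[of z "\<lbrace>z, x\<rbrace>" y] br_deriv[of z x "\<lbrace>z, y\<rbrace>"] by (simp add: sq scale_two)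
    finally show ?thesis using i by simp
  qed
  then show ?thesis by (rule centraliser_of_derived_trivial)
qed

end

lemma weight_cases:
  assumes identity: "\<And>x y. \<lbrace>\<lbrace>z, x\<rbrace>, \<lbrace>z, y\<rbrace>\<rbrace> =
    \<lbrace>z, \<lbrace>z, \<lbrace>x, y\<rbrace>\<rbrace>\<rbrace> + (2 * l + 1) \<odot> \<lbrace>z, \<lbrace>x, y\<rbrace>\<rbrace> + (l * (l + 1)) \<odot> \<lbrace>x, y\<rbrace>"
  obtains "\<And>x::'v. x = 0" | "z = 0" "l = 0" | "z = 0" "l = - 1" | "2 * l + 1 = 0"
proof -
  consider "2 * l + 1 = 0" | "2 * l + 1 \<noteq> 0" "l \<noteq> 0" "l + 1 \<noteq> 0" | "l = 0" | "l = - 1"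
    using eq_neg_iff_add_eq_0 by blast
  then show thesis
  proof cases
    case 4
    \<comment> \<open>For \<open>l = - 1\<close> the polynomial is \<open>D\<^sup>2 - D\<close>;
      passing to \<open>- z\<close> turns it into \<open>D\<^sup>2 + D\<close>, the polynomial of
      weight zero.\<close>
    have "- z = 0"
    proof (rule ad_trivial_if_weight_zero[where l = 0])
      show "\<lbrace>\<lbrace>- z, x\<rbrace>, \<lbrace>- z, y\<rbrace>\<rbrace> = \<lbrace>- z, \<lbrace>- z, \<lbrace>x, y\<rbrace>\<rbrace>\<rbrace> +
        (2 * 0 + 1) \<odot> \<lbrace>- z, \<lbrace>x, y\<rbrace>\<rbrace> + (0 * (0 + 1)) \<odot> \<lbrace>x, y\<rbrace>" for x y
        using identity[of x y] 4 by (simp add: br_simps)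
    qed simp
    with 4 that(3) show ?thesis by simp
  qed (use that degenerate_if_generic_weight[OF identity] ad_trivial_if_weight_zero[OF identity] in blast)+
qed

end

section \<open>Direct sums of copies of sl2\<close>

lemma trace_2: "trace (A :: 'a::semiring_1^2^2) = A $ 1 $ 1 + A $ 2 $ 2"
  by (simp add: trace_def sum_2)

lemma comm_in_sl2:
  assumes "A \<in> sl2" "B \<in> sl2"
  shows "comm A B \<in> sl2"
    and "comm A B $ 1 $ 1 = A $ 1 $ 2 * B $ 2 $ 1 - B $ 1 $ 2 * A $ 2 $ 1"
    and "comm A B $ 1 $ 2 = 2 * (A $ 1 $ 1 * B $ 1 $ 2 - B $ 1 $ 1 * A $ 1 $ 2)"
    and "comm A B $ 2 $ 1 = 2 * (A $ 2 $ 1 * B $ 1 $ 1 - B $ 2 $ 1 * A $ 1 $ 1)"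
proof -
  have A: "A $ 2 $ 2 = - A $ 1 $ 1" and B: "B $ 2 $ 2 = - B $ 1 $ 1"
    using assms by (simp_all add: sl2_def trace_2 eq_neg_iff_add_eq_0 add.commute)
  show "comm A B \<in> sl2"
    and "comm A B $ 1 $ 1 = A $ 1 $ 2 * B $ 2 $ 1 - B $ 1 $ 2 * A $ 2 $ 1"
    and "comm A B $ 1 $ 2 = 2 * (A $ 1 $ 1 * B $ 1 $ 2 - B $ 1 $ 1 * A $ 1 $ 2)"
    and "comm A B $ 2 $ 1 = 2 * (A $ 2 $ 1 * B $ 1 $ 1 - B $ 2 $ 1 * A $ 1 $ 1)"
    by (simp_all add: sl2_def trace_2 comm_def matrix_matrix_mult_def sum_2 A B algebra_simps)
qed

lemma sl2_eqI:
  assumes "A \<in> sl2" "B \<in> sl2" "A $ 1 $ 1 = B $ 1 $ 1" "A $ 1 $ 2 = B $ 1 $ 2" "A $ 2 $ 1 = B $ 2 $ 1"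
  shows "A = B"
proof -
  have "A $ 2 $ 2 = B $ 2 $ 2" using assms by (auto simp: sl2_def trace_2 add_eq_0_iff)
  then show ?thesis using assms by (simp add: vec_eq_iff forall_2)
qed

lemma exists_sl2: "\<exists>A. A \<in> sl2 \<and> A $ 1 $ 2 = a \<and> A $ 1 $ 1 = b \<and> A $ 2 $ 1 = c"
  by (rule exI[of _ "vector [vector [b, a], vector [c, - b]]"]) (simp add: sl2_def trace_2 vector_2)

lemma comm_0 [simp]: "comm 0 0 = 0" by (simp add: comm_def)

lemma mscale_simps [simp]: "mscale c A $ i $ j = c * A $ i $ j" "mscale c 0 = 0"
  by (simp_all add: mscale_def vec_eq_iff)

lemma sl2_closed: "A \<in> sl2 \<Longrightarrow> B \<in> sl2 \<Longrightarrow> A + B \<in> sl2" "A \<in> sl2 \<Longrightarrow> mscale c A \<in> sl2"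
  by (auto simp: sl2_def trace_2 distrib_left[symmetric])
    (metis (no_types, lifting) add.assoc add.left_commute add.right_neutral)

lemma sl2_sum_closed:
  "u \<in> sl2_sum k \<Longrightarrow> v \<in> sl2_sum k \<Longrightarrow> (\<lambda>i. u i + v i) \<in> sl2_sum k"
  "u \<in> sl2_sum k \<Longrightarrow> (\<lambda>i. mscale c (u i)) \<in> sl2_sum k"
  "u \<in> sl2_sum k \<Longrightarrow> v \<in> sl2_sum k \<Longrightarrow> (\<lambda>i. comm (u i) (v i)) \<in> sl2_sum k"
  by (auto simp: sl2_sum_def sl2_closed comm_in_sl2)

context cfd_lie
begin

text \<open>Coordinates along the triples give a linear map \<open>\<psi>\<close> from
  \<open>sl2_sum k\<close> onto the algebra; the bracket table makes it a homomorphism and also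
  forces injectivity. The isomorphism is its inverse.\<close>

lemma iso_sum_sl2I:
  fixes e h f :: "nat \<Rightarrow> 'v"
  assumes ef: "\<And>i j. i < k \<Longrightarrow> j < k \<Longrightarrow> \<lbrace>e i, f j\<rbrace> = (if i = j then h i else 0)"
    and he: "\<And>i j. i < k \<Longrightarrow> j < k \<Longrightarrow> \<lbrace>h i, e j\<rbrace> = (if i = j then 2 \<odot> e i else 0)"
    and hf: "\<And>i j. i < k \<Longrightarrow> j < k \<Longrightarrow> \<lbrace>h i, f j\<rbrace> = (if i = j then - (2 \<odot> f i) else 0)"
    and zero: "\<And>i j. i < k \<Longrightarrow> j < k \<Longrightarrow> \<lbrace>e i, e j\<rbrace> = 0"
      "\<And>i j. i < k \<Longrightarrow> j < k \<Longrightarrow> \<lbrace>f i, f j\<rbrace> = 0"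
      "\<And>i j. i < k \<Longrightarrow> j < k \<Longrightarrow> \<lbrace>h i, h j\<rbrace> = 0"
    and ne: "\<And>i. i < k \<Longrightarrow> e i \<noteq> 0"
    and spanning: "\<And>x. \<exists>a b c. x = (\<Sum>i<k. a i \<odot> e i + b i \<odot> h i + c i \<odot> f i)"
  shows "iso_sum_sl2 scale br"
proof -
  define T where "T a b c = (\<Sum>i<k. a i \<odot> e i + b i \<odot> h i + c i \<odot> f i)" for a b c
  have eh: "\<lbrace>e i, h j\<rbrace> = (if i = j then - (2 \<odot> e i) else 0)" if "i < k" "j < k" for i j
    using he[OF that(2,1)] br_anti[of "e i" "h j"] by auto
  have fe: "\<lbrace>f i, e j\<rbrace> = (if i = j then - h i else 0)" if "i < k" "j < k" for i j
    using ef[OF that(2,1)] br_anti[of "f i" "e j"] by auto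
  have fh: "\<lbrace>f i, h j\<rbrace> = (if i = j then 2 \<odot> f i else 0)" if "i < k" "j < k" for i j
    using hf[OF that(2,1)] br_anti[of "f i" "h j"] by auto
  note tab = ef he hf zero eh fe fh
  have e_T: "\<lbrace>e j, T a b c\<rbrace> = - ((2 * b j) \<odot> e j) + c j \<odot> h j"
    and h_T: "\<lbrace>h j, T a b c\<rbrace> = (2 * a j) \<odot> e j - (2 * c j) \<odot> f j"
    if j: "j < k" for j a b c
  proof -
    have "\<lbrace>e j, T a b c\<rbrace> = (\<Sum>i<k. if i = j then - ((2 * b j) \<odot> e j) + c j \<odot> h j else 0)"
      unfolding T_def br_sum_right by (rule sum.cong) (auto simp: br_simps tab j mult.commute)
    then show "\<lbrace>e j, T a b c\<rbrace> = - ((2 * b j) \<odot> e j) + c j \<odot> h j" using j by simp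
    have "\<lbrace>h j, T a b c\<rbrace> = (\<Sum>i<k. if i = j then (2 * a j) \<odot> e j - (2 * c j) \<odot> f j else 0)"
      unfolding T_def br_sum_right by (rule sum.cong) (auto simp: br_simps tab j mult.commute)
    then show "\<lbrace>h j, T a b c\<rbrace> = (2 * a j) \<odot> e j - (2 * c j) \<odot> f j" using j by simp
  qed
  \<comment> \<open>Independence is read off from brackets: applying \<open>e j\<close> twice
    isolates \<open>c j\<close>, then \<open>e j\<close> once gives \<open>b j\<close> and
    \<open>h j\<close> gives \<open>a j\<close>.\<close>
  have T_inj: "a j = 0 \<and> b j = 0 \<and> c j = 0" if T0: "T a b c = 0" and j: "j < k" for a b c j
  proof -
    have "\<lbrace>e j, \<lbrace>e j, T a b c\<rbrace>\<rbrace> = - ((2 * c j) \<odot> e j)"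
      unfolding e_T[OF j] by (simp add: br_simps tab j mult.commute)
    then have c: "c j = 0" using ne[OF j] by (simp add: T0)
    moreover have "b j = 0" using e_T[OF j, of a b c] ne[OF j] by (simp add: T0 c)
    moreover have "a j = 0" using h_T[OF j, of a b c] ne[OF j] by (simp add: T0 c)
    ultimately show ?thesis by blast
  qed
  have T_add: "T a b c + T a' b' c' = T (\<lambda>i. a i + a' i) (\<lambda>i. b i + b' i) (\<lambda>i. c i + c' i)"
    for a b c a' b' c'
    unfolding T_def sum.distrib[symmetric] by (rule sum.cong) (auto simp: algebra_simps)
  have T_scale: "t \<odot> T a b c = T (\<lambda>i. t * a i) (\<lambda>i. t * b i) (\<lambda>i. t * c i)" for t a b c
    unfolding T_def scale_sum_right by (rule sum.cong) (auto simp: algebra_simps)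
  have T_br: "\<lbrace>T a b c, T a' b' c'\<rbrace> = T (\<lambda>i. 2 * (b i * a' i - b' i * a i))
      (\<lambda>i. a i * c' i - a' i * c i) (\<lambda>i. 2 * (c i * b' i - c' i * b i))"
    for a b c a' b' c'
  proof -
    let ?t = "\<lambda>a b c i. a i \<odot> e i + b i \<odot> h i + c i \<odot> f i"
    have "\<lbrace>T a b c, T a' b' c'\<rbrace> = (\<Sum>i<k. \<Sum>j<k. \<lbrace>?t a b c i, ?t a' b' c' j\<rbrace>)"
      unfolding T_def br_sum_left br_sum_right by (rule sum.swap)
    also have "\<dots> = (\<Sum>i<k. \<Sum>j<k. if j = i then \<lbrace>?t a b c i, ?t a' b' c' i\<rbrace> else 0)"
      by (intro sum.cong refl) (auto simp: br_simps tab)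
    also have "\<dots> = (\<Sum>i<k. \<lbrace>?t a b c i, ?t a' b' c' i\<rbrace>)"
      by (intro sum.cong refl) simp
    also have "\<dots> = T (\<lambda>i. 2 * (b i * a' i - b' i * a i))
      (\<lambda>i. a i * c' i - a' i * c i) (\<lambda>i. 2 * (c i * b' i - c' i * b i))"
      unfolding T_def
      by (intro sum.cong refl) (simp add: br_simps tab algebra_simps)
    finally show ?thesis .
  qed
  \<comment> \<open>The entries above, on and below the diagonal are the coefficients of
    \<open>e\<close>, \<open>h\<close> and \<open>f\<close>, as for the standard basis of
    \<open>sl2\<close>.\<close>
  define \<psi> where "\<psi> u = T (\<lambda>i. u i $ 1 $ 2) (\<lambda>i. u i $ 1 $ 1) (\<lambda>i. u i $ 2 $ 1)"
    for u :: "nat \<Rightarrow> complex^2^2"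
  have T_cong: "T a b c = T a' b' c'"
    if "\<And>i. i < k \<Longrightarrow> a i = a' i" "\<And>i. i < k \<Longrightarrow> b i = b' i" "\<And>i. i < k \<Longrightarrow> c i = c' i"
    for a b c a' b' c'
    unfolding T_def using that by (intro sum.cong) auto
  have \<psi>_add: "\<psi> (\<lambda>i. u i + v i) = \<psi> u + \<psi> v" for u v by (simp add: \<psi>_def T_add)
  have \<psi>_scale: "\<psi> (\<lambda>i. mscale t (u i)) = t \<odot> \<psi> u" for t u by (simp add: \<psi>_def T_scale)
  have \<psi>_br: "\<psi> (\<lambda>i. comm (u i) (v i)) = \<lbrace>\<psi> u, \<psi> v\<rbrace>" if "u \<in> sl2_sum k" "v \<in> sl2_sum k" for u v
    unfolding \<psi>_def T_br using that by (intro T_cong) (auto simp: sl2_sum_def comm_in_sl2)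
  have inj: "inj_on \<psi> (sl2_sum k)"
  proof (rule inj_onI)
    fix u v assume u: "u \<in> sl2_sum k" and v: "v \<in> sl2_sum k" and eq: "\<psi> u = \<psi> v"
    \<comment> \<open>The scalar \<open>-1\<close> lets \<open>T_scale\<close> and
      \<open>T_add\<close> combine the difference into a single \<open>T\<close>.\<close>
    have "\<psi> u + (-1) \<odot> \<psi> v = 0" using eq by simp
    then have 0: "T (\<lambda>i. u i $ 1 $ 2 + -1 * v i $ 1 $ 2) (\<lambda>i. u i $ 1 $ 1 + -1 * v i $ 1 $ 1)
        (\<lambda>i. u i $ 2 $ 1 + -1 * v i $ 2 $ 1) = 0"
      unfolding \<psi>_def T_scale T_add .
    have "u i = v i" for i
    proof (cases "i < k")
      case True
      from T_inj[OF 0 True] u v True show ?thesis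
        by (intro sl2_eqI) (auto simp: sl2_sum_def)
    next
      case False
      then show ?thesis using u v by (simp add: sl2_sum_def)
    qed
    then show "u = v" ..
  qed
  have surj: "\<psi> ` sl2_sum k = UNIV"
  proof -
    have "x \<in> \<psi> ` sl2_sum k" for x
    proof -
      obtain a b c where x: "x = T a b c" using spanning[of x] unfolding T_def by blast
      obtain g where g: "\<And>i. g i \<in> sl2 \<and> g i $ 1 $ 2 = a i \<and> g i $ 1 $ 1 = b i \<and> g i $ 2 $ 1 = c i"
      proof -
        have "\<forall>i. \<exists>A. A \<in> sl2 \<and> A $ 1 $ 2 = a i \<and> A $ 1 $ 1 = b i \<and> A $ 2 $ 1 = c i"
          using exists_sl2 by blast
        from choice[OF this] show thesis using that by blast
      qed
      \<comment> \<open>Membership in \<open>sl2_sum k\<close> requires zero components from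
        \<open>k\<close> on.\<close>
      let ?u = "\<lambda>i. if i < k then g i else 0"
      have "?u \<in> sl2_sum k" using g by (simp add: sl2_sum_def)
      moreover have "\<psi> ?u = x" unfolding \<psi>_def x by (intro T_cong) (simp_all add: g)
      ultimately show ?thesis by blast
    qed
    then show ?thesis by blast
  qed
  let ?S = "sl2_sum k"
  define \<phi> where "\<phi> = the_inv_into ?S \<psi>"
  have \<phi>: "\<phi> x \<in> ?S" "\<psi> (\<phi> x) = x" for x
    using the_inv_into_into[OF inj, of x ?S] f_the_inv_into_f[OF inj, of x] surj by (auto simp: \<phi>_def)
  have \<phi>_eqI: "\<phi> x = u" if "u \<in> ?S" "\<psi> u = x" for x u
    unfolding \<phi>_def that(2)[symmetric] using that(1) by (rule the_inv_into_f_f[OF inj])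
  have "bij_betw \<phi> UNIV ?S"
    unfolding \<phi>_def using inj surj by (intro bij_betw_the_inv_into) (simp add: bij_betw_def)
  moreover have "\<phi> (x + y) = (\<lambda>i. \<phi> x i + \<phi> y i)" for x y
    by (rule \<phi>_eqI) (simp_all add: sl2_sum_closed \<phi> \<psi>_add)
  moreover have "\<phi> (c \<odot> x) = (\<lambda>i. mscale c (\<phi> x i))" for c x
    by (rule \<phi>_eqI) (simp_all add: sl2_sum_closed \<phi> \<psi>_scale)
  moreover have "\<phi> \<lbrace>x, y\<rbrace> = (\<lambda>i. comm (\<phi> x i) (\<phi> y i))" for x y
    by (rule \<phi>_eqI) (simp_all add: sl2_sum_closed \<phi> \<psi>_br)
  ultimately show ?thesis unfolding iso_sum_sl2_def by blast
qed

end

section \<open>Semisimple Lie algebras with an abelian three-term grading\<close>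

text \<open>\<open>P\<close>, \<open>Z\<close> and \<open>N\<close> behave as the parts of degree 1,
  0 and -1 of a grading; in the application they are eigenspaces of \<open>ad (2z)\<close>.\<close>

locale graded_semisimple = cfd_semisimple scale Basis br
  for scale :: "complex \<Rightarrow> 'v::ab_group_add \<Rightarrow> 'v"  (infixr \<open>\<odot>\<close> 75) and Basis
    and br (\<open>\<lbrace>_, _\<rbrace>\<close>) +
  fixes P Z N :: "'v set"
  assumes subspaces: "subspace P" "subspace Z" "subspace N"
    and PP: "x \<in> P \<Longrightarrow> y \<in> P \<Longrightarrow> \<lbrace>x, y\<rbrace> = 0"
    and ZZ: "x \<in> Z \<Longrightarrow> y \<in> Z \<Longrightarrow> \<lbrace>x, y\<rbrace> = 0"
    and NN: "x \<in> N \<Longrightarrow> y \<in> N \<Longrightarrow> \<lbrace>x, y\<rbrace> = 0"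
    and PN: "x \<in> P \<Longrightarrow> y \<in> N \<Longrightarrow> \<lbrace>x, y\<rbrace> \<in> Z"
    and ZP: "x \<in> Z \<Longrightarrow> y \<in> P \<Longrightarrow> \<lbrace>x, y\<rbrace> \<in> P"
    and ZN: "x \<in> Z \<Longrightarrow> y \<in> N \<Longrightarrow> \<lbrace>x, y\<rbrace> \<in> N"
    and decomposition: "\<exists>p\<in>P. \<exists>k\<in>Z. \<exists>n\<in>N. x = p + k + n"
begin

lemma reversed: \<comment> \<open>supplies every statement with the roles of \<open>P\<close> and \<open>N\<close> exchanged\<close>
  "graded_semisimple scale Basis br N Z P"
proof unfold_locales
  show "\<lbrace>x, y\<rbrace> \<in> Z" if "x \<in> N" "y \<in> P" for x y
    unfolding br_anti[of x y] using that PN subspace_neg subspaces by blast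
  show "\<exists>p\<in>N. \<exists>k\<in>Z. \<exists>n\<in>P. x = p + k + n" for x
    using decomposition[of x] by (metis add.commute add.left_commute)
qed (use subspaces PP ZZ NN ZP ZN in blast)+

text \<open>Jacobi with \<open>{w, x} = 0\<close>. For a weight vector \<open>e\<close> it gives
  \<open>{{e, y}, w} = {{w, y}, e}\<close>, so \<open>{e, y}\<close> maps all of \<open>P\<close>
  into the line of \<open>e\<close>.\<close>

lemma swap_P: "x \<in> P \<Longrightarrow> w \<in> P \<Longrightarrow> y \<in> N \<Longrightarrow> \<lbrace>\<lbrace>x, y\<rbrace>, w\<rbrace> = \<lbrace>\<lbrace>w, y\<rbrace>, x\<rbrace>"
  using br_deriv[of w x y] PP[of w x] br_anti[of "\<lbrace>x, y\<rbrace>" w] br_anti[of "\<lbrace>w, y\<rbrace>" x] by simp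

lemma swap_N: "x \<in> P \<Longrightarrow> v \<in> N \<Longrightarrow> y \<in> N \<Longrightarrow> \<lbrace>\<lbrace>x, y\<rbrace>, v\<rbrace> = \<lbrace>\<lbrace>x, v\<rbrace>, y\<rbrace>"
  using br_deriv[of v x y] NN[of v y] br_anti[of "\<lbrace>x, y\<rbrace>" v] br_anti[of x v]
  by (simp add: br_simps)

lemma comm_Z: "j \<in> Z \<Longrightarrow> k \<in> Z \<Longrightarrow> \<lbrace>j, \<lbrace>k, x\<rbrace>\<rbrace> = \<lbrace>k, \<lbrace>j, x\<rbrace>\<rbrace>"
  using br_deriv[of j k x] ZZ[of j k] by simp

text \<open>The bracket \<open>{x, y}\<close> lies in the abelian part \<open>Z\<close>, so
  \<open>k\<close> kills it and the Leibniz rule moves \<open>k\<close> across with a sign.\<close>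

lemma br_P_ZN: "x \<in> P \<Longrightarrow> k \<in> Z \<Longrightarrow> y \<in> N \<Longrightarrow> \<lbrace>x, \<lbrace>k, y\<rbrace>\<rbrace> = - \<lbrace>\<lbrace>k, x\<rbrace>, y\<rbrace>"
  using br_deriv[of x k y] ZZ[of k "\<lbrace>x, y\<rbrace>"] PN[of x y] br_anti[of x k] by (simp add: br_simps)

text \<open>The conditions say, degree by degree, that \<open>A + J + C\<close> is an abelian ideal;
  brackets within one degree vanish by \<open>PP\<close>, \<open>ZZ\<close> and
  \<open>NN\<close>.\<close>

lemma graded_abelian_ideal_trivial:
  assumes sub: "subspace A" "subspace J" "subspace C" "A \<subseteq> P" "J \<subseteq> Z" "C \<subseteq> N"
    and ZA: "\<And>k w. k \<in> Z \<Longrightarrow> w \<in> A \<Longrightarrow> \<lbrace>k, w\<rbrace> \<in> A"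
    and AN: "\<And>y w. y \<in> N \<Longrightarrow> w \<in> A \<Longrightarrow> \<lbrace>w, y\<rbrace> \<in> J"
    and JP: "\<And>k x. k \<in> J \<Longrightarrow> x \<in> P \<Longrightarrow> \<lbrace>k, x\<rbrace> \<in> A"
    and JN: "\<And>k y. k \<in> J \<Longrightarrow> y \<in> N \<Longrightarrow> \<lbrace>k, y\<rbrace> \<in> C"
    and PC: "\<And>x v. x \<in> P \<Longrightarrow> v \<in> C \<Longrightarrow> \<lbrace>x, v\<rbrace> \<in> J"
    and ZC: "\<And>k v. k \<in> Z \<Longrightarrow> v \<in> C \<Longrightarrow> \<lbrace>k, v\<rbrace> \<in> C"
    and JA: "\<And>k w. k \<in> J \<Longrightarrow> w \<in> A \<Longrightarrow> \<lbrace>k, w\<rbrace> = 0"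
    and AC: "\<And>w v. w \<in> A \<Longrightarrow> v \<in> C \<Longrightarrow> \<lbrace>w, v\<rbrace> = 0"
    and JC: "\<And>k v. k \<in> J \<Longrightarrow> v \<in> C \<Longrightarrow> \<lbrace>k, v\<rbrace> = 0"
  shows "A \<subseteq> {0}" "C \<subseteq> {0}"
proof -
  \<comment> \<open>The nested form lets \<open>subspace_sums\<close> apply twice.\<close>
  let ?I = "{x + y | x y. x \<in> {x + y | x y. x \<in> A \<and> y \<in> J} \<and> y \<in> C}"
  have I: "a + j + c \<in> ?I" if "a \<in> A" "j \<in> J" "c \<in> C" for a j c using that by blast
  have E: thesis if "x \<in> ?I" "\<And>a j c. a \<in> A \<Longrightarrow> j \<in> J \<Longrightarrow> c \<in> C \<Longrightarrow> x = a + j + c \<Longrightarrow> thesis" for x thesis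
    using that by blast
  have "?I \<subseteq> {0}"
  proof (rule abelian_ideal_trivial)
    show "subspace ?I" by (intro subspace_sums sub)
    show "\<lbrace>x, y\<rbrace> \<in> ?I" if "y \<in> ?I" for x y
    proof -
      obtain a j c where y: "a \<in> A" "j \<in> J" "c \<in> C" "y = a + j + c" using \<open>y \<in> ?I\<close> by (rule E)
      obtain p k n where x: "p \<in> P" "k \<in> Z" "n \<in> N" "x = p + k + n" using decomposition[of x] by blast
      have mem: "a \<in> P" "j \<in> Z" "c \<in> N" using y sub by auto
      have "\<lbrace>x, y\<rbrace> = (\<lbrace>k, a\<rbrace> - \<lbrace>j, p\<rbrace>) + (\<lbrace>p, c\<rbrace> - \<lbrace>a, n\<rbrace>) + (\<lbrace>k, c\<rbrace> - \<lbrace>j, n\<rbrace>)"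
        unfolding x(4) y(4)
        using br_anti[of p j] br_anti[of n a] br_anti[of n j] PP[OF x(1) mem(1)] ZZ[OF x(2) mem(2)]
          NN[OF x(3) mem(3)]
        by (simp add: br_simps)
      also have "\<dots> \<in> ?I"
        by (intro I subspace_diff sub ZA AN JP JN PC ZC x y)
      finally show ?thesis .
    qed
    show "\<lbrace>x, y\<rbrace> = 0" if "x \<in> ?I" "y \<in> ?I" for x y
    proof -
      obtain a j c where y: "a \<in> A" "j \<in> J" "c \<in> C" "y = a + j + c" using \<open>y \<in> ?I\<close> by (rule E)
      obtain a' j' c' where x: "a' \<in> A" "j' \<in> J" "c' \<in> C" "x = a' + j' + c'"
        using \<open>x \<in> ?I\<close> by (rule E)
      have mem: "a \<in> P" "j \<in> Z" "c \<in> N" "a' \<in> P" "j' \<in> Z" "c' \<in> N" using x y sub by auto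
      show ?thesis unfolding x(4) y(4)
        using br_anti[of a' j] br_anti[of c' a] br_anti[of c' j] PP[OF mem(4,1)] ZZ[OF mem(5,2)]
          NN[OF mem(6,3)] JA[OF x(2) y(1)] JA[OF y(2) x(1)] AC[OF x(1) y(3)] AC[OF y(1) x(3)]
          JC[OF x(2) y(3)] JC[OF y(2) x(3)]
        by (simp add: br_simps)
    qed
  qed
  moreover have "A \<subseteq> ?I" using I[of _ 0 0] sub subspace_0 by auto
  moreover have "C \<subseteq> ?I" using I[of 0 0] sub subspace_0 by auto
  ultimately show "A \<subseteq> {0}" "C \<subseteq> {0}" by (meson subset_trans)+
qed

text \<open>The annihilator of \<open>P\<close> in \<open>N\<close> is stable under \<open>Z\<close>
  by \<open>br_P_ZN\<close>, hence by itself an abelian ideal.\<close>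

lemma faithful_N:
  assumes "v \<in> N" "\<And>x. x \<in> P \<Longrightarrow> \<lbrace>x, v\<rbrace> = 0"
  shows "v = 0"
proof -
  let ?C = "{v \<in> N. \<forall>x\<in>P. \<lbrace>x, v\<rbrace> = 0}"
  have "subspace ?C"
    using subspaces(3) by (auto simp: subspace_def br_simps)
  moreover have "\<lbrace>k, v\<rbrace> \<in> ?C" if "k \<in> Z" "v \<in> ?C" for k v
    using that ZN by (simp add: br_P_ZN ZP)
  ultimately have "?C \<subseteq> {0}"
    using subspaces by (intro graded_abelian_ideal_trivial(2)[of "{0}" "{0}" ?C]) (auto simp: subspace_0)
  with assms show ?thesis by blast
qed

text \<open>By \<open>br_P_ZN\<close> and \<open>faithful_N\<close> such a \<open>k\<close> kills
  \<open>N\<close> as well as \<open>P\<close>, and it kills the abelian \<open>Z\<close>; so it is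
  central.\<close>

lemma faithful_Z:
  assumes k: "k \<in> Z" and zero: "\<And>x. x \<in> P \<Longrightarrow> \<lbrace>k, x\<rbrace> = 0"
  shows "k = 0"
proof (rule centre_trivial)
  have N: "\<lbrace>k, y\<rbrace> = 0" if "y \<in> N" for y
    by (rule faithful_N) (use that k zero ZN br_P_ZN in auto)
  show "\<lbrace>k, x\<rbrace> = 0" for x
  proof -
    obtain p j n where "p \<in> P" "j \<in> Z" "n \<in> N" "x = p + j + n" using decomposition[of x] by blast
    then show ?thesis using N zero ZZ[OF k] by (simp add: br_simps)
  qed
qed

section \<open>Weight vectors and their partners in \<open>N\<close>\<close>

definition weight_vector :: "'v \<Rightarrow> bool" where
  "weight_vector e \<longleftrightarrow> e \<in> P \<and> e \<noteq> 0 \<and> (\<forall>k\<in>Z. \<exists>c. \<lbrace>k, e\<rbrace> = c \<odot> e)"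

text \<open>The operators \<open>br k\<close> with \<open>k\<close> in \<open>Z\<close> commute
  because \<open>Z\<close> is abelian. A general \<open>W\<close> is allowed since
  \<open>sl2_system\<close> applies this to a common kernel.\<close>

lemma exists_weight_vector:
  assumes W: "subspace W" "W \<subseteq> P" "W \<noteq> {0}" and inv: "\<And>k w. k \<in> Z \<Longrightarrow> w \<in> W \<Longrightarrow> \<lbrace>k, w\<rbrace> \<in> W"
  shows "\<exists>e\<in>W. weight_vector e"
proof -
  have "\<exists>w\<in>W. w \<noteq> 0 \<and> (\<forall>T\<in>br ` Z. \<exists>c. T w = c \<odot> w)"
  proof (rule exists_common_eigenvector)
    show "Vector_Spaces.linear scale scale T" if "T \<in> br ` Z" for T using that br_linear by auto
    show "S (T x) = T (S x)" if "S \<in> br ` Z" "T \<in> br ` Z" for S T x using that comm_Z by auto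
    show "T ` W \<subseteq> W" if "T \<in> br ` Z" for T using that inv by auto
  qed (use W in auto)
  then show ?thesis using W by (auto simp: weight_vector_def)
qed

text \<open>If no such \<open>f\<close> exists, then \<open>{e, N}\<close> annihilates \<open>e\<close>, and \<open>e\<close> lies in an abelian ideal \<open>A + J + C\<close>
  whose components are described by annihilator conditions.\<close>

lemma exists_partner:
  assumes e: "weight_vector e"
  shows "\<exists>f\<in>N. \<lbrace>\<lbrace>e, f\<rbrace>, e\<rbrace> = 2 \<odot> e"
proof (rule ccontr)
  assume contra: "\<not> ?thesis"
  have eP: "e \<in> P" and e0: "e \<noteq> 0" and weight: "\<And>k. k \<in> Z \<Longrightarrow> \<exists>c. \<lbrace>k, e\<rbrace> = c \<odot> e"
    using e by (auto simp: weight_vector_def)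
  \<comment> \<open>As \<open>{e, f}\<close> lies in \<open>Z\<close>, it scales \<open>e\<close> by
    some \<open>c\<close>; a nonzero \<open>c\<close> could be normalised to 2 by rescaling
    \<open>f\<close>, against \<open>contra\<close>.\<close>
  have null: "\<lbrace>\<lbrace>e, f\<rbrace>, e\<rbrace> = 0" if f: "f \<in> N" for f
  proof -
    obtain c where c: "\<lbrace>\<lbrace>e, f\<rbrace>, e\<rbrace> = c \<odot> e" using weight PN eP f by blast
    have "c = 0"
    proof (rule ccontr)
      assume "c \<noteq> 0"
      then have "\<lbrace>\<lbrace>e, (2 / c) \<odot> f\<rbrace>, e\<rbrace> = 2 \<odot> e" by (simp add: br_simps c)
      with contra subspace_scale[OF subspaces(3) f] show False by blast
    qed
    with c show ?thesis by simp
  qed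
  \<comment> \<open>\<open>J\<close> is large enough to contain \<open>{e, N}\<close>, by
    \<open>null\<close> and \<open>swap_P\<close>, and \<open>C\<close> to contain
    \<open>{J, N}\<close>; the condition \<open>{j, e} = 0\<close> in \<open>J\<close> is what makes
    the sum abelian.\<close>
  define A where "A = span {e}"
  define J where "J = {j \<in> Z. \<lbrace>j, e\<rbrace> = 0 \<and> (\<forall>w\<in>P. \<lbrace>j, w\<rbrace> \<in> A)}"
  define C where "C = {y \<in> N. \<forall>w\<in>P. \<lbrace>w, y\<rbrace> \<in> J}"
  have A_iff: "w \<in> A \<longleftrightarrow> (\<exists>c. w = c \<odot> e)" for w by (auto simp: A_def span_singleton)
  have sA: "subspace A" by (simp add: A_def)
  have sJ: "subspace J"
    using subspaces(2) sA by (simp add: subspace_def J_def br_simps)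
  have sC: "subspace C"
    using subspaces(3) sJ by (simp add: subspace_def C_def br_simps)
  have AN: "\<lbrace>w, y\<rbrace> \<in> J" if w: "w \<in> A" and y: "y \<in> N" for w y
  proof -
    have "\<lbrace>\<lbrace>e, y\<rbrace>, x\<rbrace> \<in> A" if x: "x \<in> P" for x
      unfolding swap_P[OF eP x y] A_iff by (rule weight[OF PN[OF x y]])
    then have "\<lbrace>e, y\<rbrace> \<in> J" using null[OF y] PN[OF eP y] by (simp add: J_def)
    moreover obtain c where "w = c \<odot> e" using w A_iff by blast
    ultimately show ?thesis using subspace_scale[OF sJ] by (simp only: br_scale_left)
  qed
  have AC: "\<lbrace>w, v\<rbrace> = 0" if w: "w \<in> A" and v: "v \<in> C" for w v
  proof -
    have vN: "v \<in> N" using v by (simp add: C_def)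
    \<comment> \<open>By \<open>swap_P\<close>, \<open>{e, v}\<close> sends \<open>x\<close> to
      \<open>{{x, v}, e}\<close>, which is zero because \<open>{x, v}\<close> lies in
      \<open>J\<close>.\<close>
    have "\<lbrace>e, v\<rbrace> = 0"
    proof (rule faithful_Z)
      show "\<lbrace>e, v\<rbrace> \<in> Z" using PN[OF eP vN] .
      show "\<lbrace>\<lbrace>e, v\<rbrace>, x\<rbrace> = 0" if x: "x \<in> P" for x
        using v x unfolding swap_P[OF eP x vN] by (simp add: C_def J_def)
    qed
    then show ?thesis using w by (auto simp: A_iff br_simps)
  qed
  have "A \<subseteq> {0}"
  proof (rule graded_abelian_ideal_trivial(1)[OF sA sJ sC])
    show "A \<subseteq> P" using subspace_scale[OF subspaces(1) eP] by (auto simp: A_iff)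
    show "J \<subseteq> Z" "C \<subseteq> N" by (auto simp: J_def C_def)
    show "\<lbrace>k, w\<rbrace> \<in> A" if kw: "k \<in> Z" "w \<in> A" for k w
    proof -
      obtain c where w: "w = c \<odot> e" using kw(2) A_iff by blast
      obtain d where d: "\<lbrace>k, e\<rbrace> = d \<odot> e" using weight kw(1) by blast
      show ?thesis unfolding w A_iff br_scale_right d scale_scale by (rule exI, rule refl)
    qed
    show "\<lbrace>k, x\<rbrace> \<in> A" if "k \<in> J" "x \<in> P" for k x using that by (simp add: J_def)
    show "\<lbrace>x, y\<rbrace> \<in> J" if "x \<in> P" "y \<in> C" for x y using that by (simp add: C_def)
    show "\<lbrace>k, w\<rbrace> = 0" if "k \<in> J" "w \<in> A" for k w
      using that by (auto simp: J_def A_iff br_scale_right)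
    show "\<lbrace>k, y\<rbrace> \<in> C" if k: "k \<in> J" and y: "y \<in> N" for k y
    proof -
      have kZ: "k \<in> Z" using k by (simp add: J_def)
      have "\<lbrace>w, \<lbrace>k, y\<rbrace>\<rbrace> \<in> J" if w: "w \<in> P" for w
        unfolding br_P_ZN[OF w kZ y]
        by (rule subspace_neg[OF sJ], rule AN[OF _ y]) (use k w in \<open>simp add: J_def\<close>)
      then show ?thesis using ZN[OF kZ y] by (simp add: C_def)
    qed
    show "\<lbrace>k, y\<rbrace> \<in> C" if k: "k \<in> Z" and y: "y \<in> C" for k y
    proof -
      have yN: "y \<in> N" using y by (simp add: C_def)
      have "\<lbrace>w, \<lbrace>k, y\<rbrace>\<rbrace> \<in> J" if w: "w \<in> P" for w
        unfolding br_P_ZN[OF w k yN]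
        by (rule subspace_neg[OF sJ]) (use ZP[OF k w] y in \<open>simp add: C_def\<close>)
      then show ?thesis using ZN[OF k yN] by (simp add: C_def)
    qed
    show "\<lbrace>k, v\<rbrace> = 0" if k: "k \<in> J" and v: "v \<in> C" for k v
    proof (rule faithful_N)
      have kv: "k \<in> Z" "v \<in> N" using k v by (simp_all add: J_def C_def)
      show "\<lbrace>k, v\<rbrace> \<in> N" using ZN[OF kv] .
      show "\<lbrace>x, \<lbrace>k, v\<rbrace>\<rbrace> = 0" if x: "x \<in> P" for x
      proof -
        have "\<lbrace>\<lbrace>k, x\<rbrace>, v\<rbrace> = 0" using k x by (intro AC v) (simp add: J_def)
        then show ?thesis unfolding br_P_ZN[OF x kv] by simp
      qed
    qed
  qed (rule AN AC; assumption)+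
  moreover have "e \<in> A" by (simp add: A_def span_base)
  ultimately show False using e0 by blast
qed

section \<open>Triples and their symmetry between \<open>P\<close> and \<open>N\<close>\<close>

definition triple :: "'v \<Rightarrow> 'v \<Rightarrow> bool" where
  "triple e f \<longleftrightarrow> weight_vector e \<and> f \<in> N \<and>
    \<lbrace>\<lbrace>e, f\<rbrace>, e\<rbrace> = 2 \<odot> e \<and> \<lbrace>\<lbrace>e, f\<rbrace>, f\<rbrace> = - (2 \<odot> f)"

text \<open>A partner \<open>f\<close> may fail \<open>{h, f} = - 2 f\<close>. The defect
  \<open>u\<close> commutes with \<open>e\<close>, hence is killed by \<open>h\<close> through
  \<open>swap_N\<close>, so subtracting half of it from \<open>f\<close> repairs the relation and
  keeps \<open>h\<close>.\<close>

lemma exists_triple: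
  assumes e: "weight_vector e"
  shows "\<exists>f. triple e f"
proof -
  have eP: "e \<in> P" using e by (simp add: weight_vector_def)
  obtain f where f: "f \<in> N" and he: "\<lbrace>\<lbrace>e, f\<rbrace>, e\<rbrace> = 2 \<odot> e" using exists_partner[OF e] by blast
  define h where "h = \<lbrace>e, f\<rbrace>"
  have hZ: "h \<in> Z" unfolding h_def using eP f by (rule PN)
  define u where "u = \<lbrace>h, f\<rbrace> + 2 \<odot> f"
  have uN: "u \<in> N"
    unfolding u_def using subspaces f hZ by (intro subspace_add subspace_scale ZN)
  have "\<lbrace>e, \<lbrace>h, f\<rbrace>\<rbrace> = - (2 \<odot> h)"
    unfolding br_P_ZN[OF eP hZ f] by (simp add: h_def he br_simps)
  then have eu: "\<lbrace>e, u\<rbrace> = 0" by (simp add: u_def h_def br_simps)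
  have hu: "\<lbrace>h, u\<rbrace> = 0" unfolding h_def swap_N[OF eP uN f] eu by simp
  define f' where "f' = f - (1 / 2) \<odot> u"
  have ef': "\<lbrace>e, f'\<rbrace> = h" by (simp add: f'_def br_simps eu h_def)
  have "\<lbrace>h, f'\<rbrace> = \<lbrace>h, f\<rbrace>" by (simp add: f'_def br_simps hu)
  also have "\<dots> = - (2 \<odot> f')" by (simp add: f'_def u_def algebra_simps scale_two)
  finally have "triple e f'"
    unfolding triple_def ef' using e he subspaces f uN
    by (auto simp: h_def f'_def intro!: subspace_diff subspace_scale)
  then show ?thesis ..
qed

text \<open>By \<open>swap_P\<close> the bracket equals \<open>{{w, f}, e}\<close>, and
  \<open>{w, f}\<close> in \<open>Z\<close> scales \<open>e\<close>. Thus \<open>h\<close> has rank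
  one on \<open>P\<close>.\<close>

lemma triple_split_P:
  assumes t: "triple e f" and w: "w \<in> P"
  shows "\<exists>c. \<lbrace>\<lbrace>e, f\<rbrace>, w\<rbrace> = c \<odot> e"
proof -
  have "e \<in> P" "f \<in> N" and weight: "\<And>k. k \<in> Z \<Longrightarrow> \<exists>c. \<lbrace>k, e\<rbrace> = c \<odot> e"
    using t by (auto simp: triple_def weight_vector_def)
  then show ?thesis using swap_P[of e w f] PN w by simp
qed

text \<open>With \<open>y' = y - c f\<close> chosen such that \<open>k = {e, y'}\<close> annihilates \<open>e\<close>, the operator \<open>k\<close> maps \<open>P\<close> into the line
  of \<open>e\<close>, on which \<open>h = {e, f}\<close> is \<open>2\<close>, while \<open>h k = k h = 0\<close> on \<open>P\<close>; so \<open>k = 0\<close>.\<close>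

lemma triple_split_N:
  assumes t: "triple e f" and y: "y \<in> N"
  shows "\<exists>c. \<lbrace>e, y - c \<odot> f\<rbrace> = 0"
proof -
  define h where "h = \<lbrace>e, f\<rbrace>"
  have eP: "e \<in> P" and e0: "e \<noteq> 0" and f: "f \<in> N" and he: "\<lbrace>h, e\<rbrace> = 2 \<odot> e"
    and weight: "\<And>k. k \<in> Z \<Longrightarrow> \<exists>c. \<lbrace>k, e\<rbrace> = c \<odot> e"
    using t by (auto simp: triple_def weight_vector_def h_def)
  have hZ: "h \<in> Z" unfolding h_def using eP f by (rule PN)
  obtain c where c: "\<lbrace>\<lbrace>e, y\<rbrace>, e\<rbrace> = c \<odot> e" using weight PN[OF eP y] by blast
  define y' where "y' = y - (c / 2) \<odot> f"
  have y': "y' \<in> N" unfolding y'_def using subspaces y f by (intro subspace_diff subspace_scale)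
  define k where "k = \<lbrace>e, y'\<rbrace>"
  have kZ: "k \<in> Z" unfolding k_def using eP y' by (rule PN)
  have ke: "\<lbrace>k, e\<rbrace> = 0"
    by (simp add: k_def y'_def br_simps c h_def[symmetric] he)
  have "k = 0"
  proof (rule faithful_Z[OF kZ])
    fix w assume w: "w \<in> P"
    obtain d where d: "\<lbrace>k, w\<rbrace> = d \<odot> e"
      unfolding k_def swap_P[OF eP w y'] using weight PN[OF w y'] by blast
    obtain d' where d': "\<lbrace>h, w\<rbrace> = d' \<odot> e" using triple_split_P[OF t w] h_def by blast
    have "\<lbrace>h, \<lbrace>k, w\<rbrace>\<rbrace> = 0"
      unfolding comm_Z[OF hZ kZ] d' by (simp add: br_simps ke)
    then show "\<lbrace>k, w\<rbrace> = 0" using e0 unfolding d by (simp add: br_simps he)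
  qed
  then show ?thesis unfolding k_def y'_def by blast
qed

lemma triple_nonzero:
  assumes "triple e f"
  shows "f \<noteq> 0"
  using assms by (auto simp: triple_def weight_vector_def)

text \<open>In \<open>y = (y - c f) + c f\<close> the first summand commutes with \<open>e\<close>,
  so \<open>h\<close> kills it by \<open>swap_N\<close>, and \<open>{h, y} = - 2 c f\<close> forces
  \<open>c = 0\<close>.\<close>

lemma triple_kernel_N:
  assumes t: "triple e f" and y: "y \<in> N" and "\<lbrace>\<lbrace>e, f\<rbrace>, y\<rbrace> = 0"
  shows "\<lbrace>e, y\<rbrace> = 0"
proof -
  have eP: "e \<in> P" and f: "f \<in> N" and hf: "\<lbrace>\<lbrace>e, f\<rbrace>, f\<rbrace> = - (2 \<odot> f)"
    using t by (auto simp: triple_def weight_vector_def)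
  obtain c where c: "\<lbrace>e, y - c \<odot> f\<rbrace> = 0" using triple_split_N[OF t y] by blast
  have y': "y - c \<odot> f \<in> N" using subspaces y f by (intro subspace_diff subspace_scale)
  have "\<lbrace>\<lbrace>e, f\<rbrace>, y - c \<odot> f\<rbrace> = 0" unfolding swap_N[OF eP y' f] c by simp
  then have "c = 0" using assms(3) triple_nonzero[OF t] by (simp add: br_simps hf)
  with c show ?thesis by simp
qed

text \<open>The point is that \<open>f\<close> is a weight vector. Some \<open>{k, f} - c f\<close>
  commutes with \<open>e\<close> and is therefore killed by \<open>h\<close>; but \<open>h\<close>
  commutes with \<open>k\<close>, so it acts on this difference as \<open>-2\<close>.\<close>

lemma triple_reversed:
  assumes t: "triple e f"
  shows "graded_semisimple.triple scale br N Z P f e"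
proof -
  interpret rev: graded_semisimple scale Basis br N Z P by (rule reversed)
  have eP: "e \<in> P" and f: "f \<in> N" and hf: "\<lbrace>\<lbrace>e, f\<rbrace>, f\<rbrace> = - (2 \<odot> f)"
    and he: "\<lbrace>\<lbrace>e, f\<rbrace>, e\<rbrace> = 2 \<odot> e"
    using t by (auto simp: triple_def weight_vector_def)
  have hZ: "\<lbrace>e, f\<rbrace> \<in> Z" using eP f by (rule PN)
  have "\<exists>c. \<lbrace>k, f\<rbrace> = c \<odot> f" if k: "k \<in> Z" for k
  proof -
    have kf: "\<lbrace>k, f\<rbrace> \<in> N" using k f by (rule ZN)
    obtain c where c: "\<lbrace>e, \<lbrace>k, f\<rbrace> - c \<odot> f\<rbrace> = 0" using triple_split_N[OF t kf] by blast
    have y': "\<lbrace>k, f\<rbrace> - c \<odot> f \<in> N" using subspaces kf f by (intro subspace_diff subspace_scale)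
    have "\<lbrace>\<lbrace>e, f\<rbrace>, \<lbrace>k, f\<rbrace> - c \<odot> f\<rbrace> = 0" unfolding swap_N[OF eP y' f] c by simp
    then have "- (2 \<odot> \<lbrace>k, f\<rbrace>) = - ((2 * c) \<odot> f)"
      by (simp add: br_simps hf comm_Z[OF hZ k] mult.commute)
    then have "2 \<odot> \<lbrace>k, f\<rbrace> = 2 \<odot> (c \<odot> f)" by simp
    then have "\<lbrace>k, f\<rbrace> = c \<odot> f" by (subst (asm) scale_cancel_left) simp
    then show ?thesis ..
  qed
  then show ?thesis
    unfolding rev.triple_def rev.weight_vector_def
    using eP f triple_nonzero[OF t] hf he br_anti[of f e] by (simp add: br_simps)
qed

lemma triple_kernel_P:
  assumes t: "triple e f" and w: "w \<in> P" and "\<lbrace>\<lbrace>e, f\<rbrace>, w\<rbrace> = 0"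
  shows "\<lbrace>f, w\<rbrace> = 0"
proof -
  interpret rev: graded_semisimple scale Basis br N Z P by (rule reversed)
  show ?thesis
    by (rule rev.triple_kernel_N[OF triple_reversed[OF t] w])
      (use assms(3) br_anti[of f e] in \<open>simp add: br_simps\<close>)
qed

text \<open>\<open>B\<close> is a maximal independent set of weight vectors; the last property holds because the common kernel
  of the \<open>{b, f b}\<close> in \<open>P\<close> would contain a further weight vector.\<close>

lemma sl2_system:
  obtains B f where "finite B"
    and "\<And>b. b \<in> B \<Longrightarrow> triple b (f b)"
    and "\<And>b b'. b \<in> B \<Longrightarrow> b' \<in> B \<Longrightarrow> b \<noteq> b' \<Longrightarrow> \<lbrace>\<lbrace>b, f b\<rbrace>, b'\<rbrace> = 0"
    and "\<And>w. w \<in> P \<Longrightarrow> (\<And>b. b \<in> B \<Longrightarrow> \<lbrace>\<lbrace>b, f b\<rbrace>, w\<rbrace> = 0) \<Longrightarrow> w = 0"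
proof -
  obtain B where B: "B \<subseteq> Collect weight_vector" "independent B" "Collect weight_vector \<subseteq> span B"
    using maximal_independent_subset by blast
  have fin: "finite B" using B(2) by (rule finiteI_independent)
  have "\<forall>b\<in>B. \<exists>f. triple b f" using B(1) exists_triple by blast
  from bchoice[OF this] obtain f where t: "\<And>b. b \<in> B \<Longrightarrow> triple b (f b)" by blast
  have bP: "b \<in> P" and b0: "b \<noteq> 0" and weight: "\<And>k. k \<in> Z \<Longrightarrow> \<exists>c. \<lbrace>k, b\<rbrace> = c \<odot> b"
    and hZ: "\<lbrace>b, f b\<rbrace> \<in> Z" and hb: "\<lbrace>\<lbrace>b, f b\<rbrace>, b\<rbrace> = 2 \<odot> b"
    if "b \<in> B" for b
    using t[OF that] PN by (auto simp: triple_def weight_vector_def)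
  have orth: "\<lbrace>\<lbrace>b, f b\<rbrace>, b'\<rbrace> = 0" if b: "b \<in> B" and b': "b' \<in> B" and ne: "b \<noteq> b'" for b b'
  proof -
    \<comment> \<open>The bracket lies on the line of \<open>b\<close> by rank one and on the line
      of \<open>b'\<close> by weight, and these lines are independent.\<close>
    obtain c where c: "\<lbrace>\<lbrace>b, f b\<rbrace>, b'\<rbrace> = c \<odot> b" using triple_split_P[OF t[OF b] bP[OF b']] by blast
    obtain d where d: "\<lbrace>\<lbrace>b, f b\<rbrace>, b'\<rbrace> = d \<odot> b'" using weight[OF b' hZ[OF b]] by blast
    have "c = 0"
    proof (rule ccontr)
      assume "c \<noteq> 0"
      then have "b = (d / c) \<odot> b'" using c d
        by (metis divide_inverse_commute scale_one scale_scale left_inverse)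
      moreover have "b' \<in> span (B - {b})" using b' ne by (intro span_base) auto
      ultimately have "b \<in> span (B - {b})" using span_scale by metis
      then show False using B(2) b by (auto simp: dependent_def)
    qed
    with c show ?thesis by simp
  qed
  have null: "w = 0" if w: "w \<in> P" "\<And>b. b \<in> B \<Longrightarrow> \<lbrace>\<lbrace>b, f b\<rbrace>, w\<rbrace> = 0" for w
  proof -
    define W where "W = {w \<in> P. \<forall>b\<in>B. \<lbrace>\<lbrace>b, f b\<rbrace>, w\<rbrace> = 0}"
    have "W = {0}"
    proof (rule ccontr)
      assume W0: "W \<noteq> {0}"
      have "subspace W" using subspaces(1) by (simp add: W_def subspace_def br_simps)
      moreover have "W \<subseteq> P" by (auto simp: W_def)
      moreover have "\<lbrace>k, w\<rbrace> \<in> W" if "k \<in> Z" "w \<in> W" for k w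
        using that ZP[OF that(1), of w] comm_Z[OF hZ that(1), of _ w] by (simp add: W_def)
      ultimately obtain e where e: "e \<in> W" "weight_vector e"
        using exists_weight_vector[OF _ _ W0] by blast
      then have "e \<in> span B" using B(3) by blast
      then obtain a where a: "e = (\<Sum>b\<in>B. a b \<odot> b)" by (auto simp: span_finite[OF fin])
      have "a b = 0" if b: "b \<in> B" for b
      proof -
        \<comment> \<open>Bracketing with \<open>{b, f b}\<close> isolates the coefficient
          \<open>a b\<close>, while membership in \<open>W\<close> makes the result zero.\<close>
        have "\<lbrace>\<lbrace>b, f b\<rbrace>, e\<rbrace> = (\<Sum>b'\<in>B. if b' = b then (2 * a b) \<odot> b else 0)"
          unfolding a br_sum_right
          by (rule sum.cong) (auto simp: br_scale_right hb b orth mult.commute)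
        then have "(2 * a b) \<odot> b = 0" using e(1) b fin by (simp add: W_def)
        then show ?thesis using b0[OF b] by simp
      qed
      then have "e = 0" by (simp add: a)
      then show False using e(2) by (simp add: weight_vector_def)
    qed
    moreover have "w \<in> W" using w by (simp add: W_def)
    ultimately show ?thesis by simp
  qed
  show thesis using fin t orth null by (rule that)
qed

text \<open>\<open>B\<close> spans \<open>P\<close>, the \<open>f b\<close> span \<open>N\<close>
  and the \<open>h b\<close> span \<open>Z\<close>: in each part a suitable combination is
  subtracted, and the remainder vanishes by \<open>null\<close>, \<open>faithful_N\<close> or
  \<open>faithful_Z\<close>.\<close>

lemma graded_iso_sum_sl2: "iso_sum_sl2 scale br"
proof -
  obtain B f where fin: "finite B" and t: "\<And>b. b \<in> B \<Longrightarrow> triple b (f b)"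
    and orth: "\<And>b b'. b \<in> B \<Longrightarrow> b' \<in> B \<Longrightarrow> b \<noteq> b' \<Longrightarrow> \<lbrace>\<lbrace>b, f b\<rbrace>, b'\<rbrace> = 0"
    and null: "\<And>w. w \<in> P \<Longrightarrow> (\<And>b. b \<in> B \<Longrightarrow> \<lbrace>\<lbrace>b, f b\<rbrace>, w\<rbrace> = 0) \<Longrightarrow> w = 0"
    using sl2_system by metis
  define h where "h b = \<lbrace>b, f b\<rbrace>" for b
  have bP: "b \<in> P" and b0: "b \<noteq> 0" and weight: "\<And>k. k \<in> Z \<Longrightarrow> \<exists>c. \<lbrace>k, b\<rbrace> = c \<odot> b"
    and fN: "f b \<in> N" and hZ: "h b \<in> Z" and hb: "\<lbrace>h b, b\<rbrace> = 2 \<odot> b"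
    and hf: "\<lbrace>h b, f b\<rbrace> = - (2 \<odot> f b)" if "b \<in> B" for b
    using t[OF that] PN by (auto simp: triple_def weight_vector_def h_def)
  \<comment> \<open>The element \<open>{b, f b}\<close> kills \<open>b'\<close>, hence so does
    \<open>f b\<close>, by \<open>triple_kernel_P\<close>.\<close>
  have bf: "\<lbrace>b', f b\<rbrace> = 0" if "b \<in> B" "b' \<in> B" "b \<noteq> b'" for b b'
    using triple_kernel_P[OF t[OF that(1)] bP[OF that(2)] orth[OF that]] br_anti[of b' "f b"] by simp
  have hf0: "\<lbrace>h b, f b'\<rbrace> = 0" if "b \<in> B" "b' \<in> B" "b \<noteq> b'" for b b'
    unfolding h_def swap_N[OF bP[OF that(1)] fN[OF that(2)] fN[OF that(1)]]
    using bf[OF that(2,1)] that(3) by simp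
  have P: "\<exists>a. w = (\<Sum>b\<in>B. a b \<odot> b)" if w: "w \<in> P" for w
  proof -
    obtain c where c: "\<And>b. b \<in> B \<Longrightarrow> \<lbrace>h b, w\<rbrace> = c b \<odot> b"
      using triple_split_P[OF t w] unfolding h_def by metis
    \<comment> \<open>The coefficients are halved because \<open>h b\<close> acts on
      \<open>b\<close> as 2.\<close>
    have "w - (\<Sum>b\<in>B. (c b / 2) \<odot> b) = 0"
    proof (rule null)
      show "w - (\<Sum>b\<in>B. (c b / 2) \<odot> b) \<in> P"
        using subspaces w bP by (intro subspace_diff subspace_sum subspace_scale)
      fix b assume b: "b \<in> B"
      have "\<lbrace>h b, \<Sum>b\<in>B. (c b / 2) \<odot> b\<rbrace> = (\<Sum>b'\<in>B. if b' = b then c b \<odot> b else 0)"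
        unfolding br_sum_right
        by (rule sum.cong) (auto simp: br_scale_right hb b orth[folded h_def])
      then show "\<lbrace>\<lbrace>b, f b\<rbrace>, w - (\<Sum>b\<in>B. (c b / 2) \<odot> b)\<rbrace> = 0"
        using b fin unfolding h_def[symmetric] by (simp add: br_diff_right c)
    qed
    then have "w = (\<Sum>b\<in>B. (c b / 2) \<odot> b)" by simp
    then show ?thesis by (rule exI[of _ "\<lambda>b. c b / 2"])
  qed
  have P_null: "\<lbrace>x, y\<rbrace> = 0" if "x \<in> P" "\<And>b. b \<in> B \<Longrightarrow> \<lbrace>b, y\<rbrace> = 0" for x y
    using P[OF that(1)] that(2) by (auto simp: br_sum_left br_scale_left)
  have N: "\<exists>a. y = (\<Sum>b\<in>B. a b \<odot> f b)" if y: "y \<in> N" for y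
  proof -
    obtain c where c: "\<And>b. b \<in> B \<Longrightarrow> \<lbrace>b, y - c b \<odot> f b\<rbrace> = 0"
      using triple_split_N[OF t y] by metis
    have "y - (\<Sum>b\<in>B. c b \<odot> f b) = 0"
    proof (rule faithful_N)
      show "y - (\<Sum>b\<in>B. c b \<odot> f b) \<in> N"
        using subspaces y fN by (intro subspace_diff subspace_sum subspace_scale)
      show "\<lbrace>x, y - (\<Sum>b\<in>B. c b \<odot> f b)\<rbrace> = 0" if "x \<in> P" for x
      proof (rule P_null[OF that])
        fix b assume b: "b \<in> B"
        have "\<lbrace>b, \<Sum>b\<in>B. c b \<odot> f b\<rbrace> = (\<Sum>b'\<in>B. if b' = b then c b \<odot> h b else 0)"
          unfolding br_sum_right
          by (rule sum.cong) (auto simp: br_scale_right bf b h_def)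
        then show "\<lbrace>b, y - (\<Sum>b\<in>B. c b \<odot> f b)\<rbrace> = 0"
          using c[OF b] b fin by (simp add: br_diff_right br_scale_right h_def)
      qed
    qed
    then show ?thesis by (intro exI[of _ c]) simp
  qed
  have Z: "\<exists>a. k = (\<Sum>b\<in>B. a b \<odot> h b)" if k: "k \<in> Z" for k
  proof -
    have "\<forall>b\<in>B. \<exists>c. \<lbrace>k, b\<rbrace> = c \<odot> b" using weight k by blast
    from bchoice[OF this] obtain c where c: "\<And>b. b \<in> B \<Longrightarrow> \<lbrace>k, b\<rbrace> = c b \<odot> b" by blast
    have "k - (\<Sum>b\<in>B. (c b / 2) \<odot> h b) = 0"
    proof (rule faithful_Z)
      show "k - (\<Sum>b\<in>B. (c b / 2) \<odot> h b) \<in> Z"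
        using subspaces k hZ by (intro subspace_diff subspace_sum subspace_scale)
      show "\<lbrace>k - (\<Sum>b\<in>B. (c b / 2) \<odot> h b), x\<rbrace> = 0" if "x \<in> P" for x
      proof -
        have "\<lbrace>x, k - (\<Sum>b\<in>B. (c b / 2) \<odot> h b)\<rbrace> = 0"
        proof (rule P_null[OF that])
          fix b assume b: "b \<in> B"
          have "\<lbrace>\<Sum>b\<in>B. (c b / 2) \<odot> h b, b\<rbrace> = (\<Sum>b'\<in>B. if b' = b then c b \<odot> b else 0)"
            unfolding br_sum_left
            by (rule sum.cong) (auto simp: br_scale_left hb b orth[folded h_def])
          then have "\<lbrace>k - (\<Sum>b\<in>B. (c b / 2) \<odot> h b), b\<rbrace> = 0"
            using b fin by (simp add: br_diff_left c)
          then show "\<lbrace>b, k - (\<Sum>b\<in>B. (c b / 2) \<odot> h b)\<rbrace> = 0"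
            using br_anti[of b "k - (\<Sum>b\<in>B. (c b / 2) \<odot> h b)"] by simp
        qed
        then show ?thesis using br_anti[of "k - (\<Sum>b\<in>B. (c b / 2) \<odot> h b)" x] by simp
      qed
    qed
    then show ?thesis by (intro exI[of _ "\<lambda>b. c b / 2"]) simp
  qed
  obtain g where g: "bij_betw g {..<card B} B"
    using ex_bij_betw_nat_finite[OF fin] by (auto simp: atLeast0LessThan)
  have gB: "g i \<in> B" if "i < card B" for i using g that by (auto simp: bij_betw_def)
  have g_eq: "g i = g j \<longleftrightarrow> i = j" if "i < card B" "j < card B" for i j
    using g that by (auto simp: bij_betw_def inj_on_def)
  show ?thesis
  proof (rule iso_sum_sl2I[where k = "card B" and e = g and h = "\<lambda>i. h (g i)" and f = "\<lambda>i. f (g i)"])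
    show "\<exists>a b c. x = (\<Sum>i<card B. a i \<odot> g i + b i \<odot> h (g i) + c i \<odot> f (g i))" for x
    proof -
      obtain p k n where x: "p \<in> P" "k \<in> Z" "n \<in> N" "x = p + k + n" using decomposition[of x] by blast
      obtain a b c where abc: "p = (\<Sum>b\<in>B. a b \<odot> b)" "k = (\<Sum>r\<in>B. b r \<odot> h r)"
        "n = (\<Sum>b\<in>B. c b \<odot> f b)"
        using P[OF x(1)] Z[OF x(2)] N[OF x(3)] by blast
      have "x = (\<Sum>r\<in>B. a r \<odot> r + b r \<odot> h r + c r \<odot> f r)"
        by (simp add: x(4) abc sum.distrib)
      also have "\<dots> = (\<Sum>i<card B. a (g i) \<odot> g i + b (g i) \<odot> h (g i) + c (g i) \<odot> f (g i))"
        by (rule sum.reindex_bij_betw[OF g, symmetric])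
      finally show ?thesis by (intro exI)
    qed
  qed (auto simp: gB g_eq b0 hb hf hf0 orth[folded h_def] bf PP NN ZZ bP fN hZ h_def[symmetric])
qed

end

section \<open>Post-Lie structures\<close>

context cfd_semisimple
begin

text \<open>On two eigenvectors of equal eigenvalue 1 or -1, \<open>D\<^sup>2\<close> acts on the
  bracket as 4, so \<open>identity\<close> reads \<open>{x, y} = 3 {x, y}\<close>; for eigenvalue 0
  it reads \<open>0 = - {x, y}\<close>. The other inclusions are the Leibniz rule.\<close>

lemma graded_of_half_weight:
  assumes identity: "\<And>x y. \<lbrace>\<lbrace>z, x\<rbrace>, \<lbrace>z, y\<rbrace>\<rbrace> = \<lbrace>z, \<lbrace>z, \<lbrace>x, y\<rbrace>\<rbrace>\<rbrace> - \<lbrace>x, y\<rbrace>"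
  shows "graded_semisimple scale Basis br {x. \<lbrace>z, x\<rbrace> = x} {x. \<lbrace>z, x\<rbrace> = 0} {x. \<lbrace>z, x\<rbrace> = - x}"
    (is "graded_semisimple _ _ _ ?P ?Z ?N")
proof unfold_locales
  have cubic: "\<lbrace>z, \<lbrace>z, \<lbrace>z, x\<rbrace>\<rbrace>\<rbrace> = \<lbrace>z, x\<rbrace>" for x using identity[of z x] by simp
  have two: "v = 0" if "v + v = (0::'v)" for v
  proof -
    have "2 \<odot> v = 0" using that by (simp add: scale_two)
    then show ?thesis by simp
  qed
  show "subspace ?P" "subspace ?Z" "subspace ?N" by (auto simp: subspace_def br_simps)
  show "\<lbrace>x, y\<rbrace> = 0" if "x \<in> ?P" "y \<in> ?P" for x y
  proof -
    have "\<lbrace>x, y\<rbrace> + \<lbrace>x, y\<rbrace> = 0"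
      using identity[of x y] that by (simp add: br_deriv[of z x y] br_simps)
    then show ?thesis by (rule two)
  qed
  show "\<lbrace>x, y\<rbrace> = 0" if "x \<in> ?N" "y \<in> ?N" for x y
  proof -
    have "\<lbrace>x, y\<rbrace> + \<lbrace>x, y\<rbrace> = 0"
      using identity[of x y] that by (simp add: br_deriv[of z x y] br_simps)
    then show ?thesis by (rule two)
  qed
  show "\<lbrace>x, y\<rbrace> = 0" if "x \<in> ?Z" "y \<in> ?Z" for x y
    using identity[of x y] that by (simp add: br_deriv[of z x y])
  show "\<lbrace>x, y\<rbrace> \<in> ?Z" if "x \<in> ?P" "y \<in> ?N" for x y using that by (simp add: br_deriv[of z x y] br_simps)
  show "\<lbrace>x, y\<rbrace> \<in> ?P" if "x \<in> ?Z" "y \<in> ?P" for x y using that by (simp add: br_deriv[of z x y])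
  show "\<lbrace>x, y\<rbrace> \<in> ?N" if "x \<in> ?Z" "y \<in> ?N" for x y using that by (simp add: br_deriv[of z x y] br_simps)
  show "\<exists>p\<in>?P. \<exists>k\<in>?Z. \<exists>n\<in>?N. x = p + k + n" for x
  proof (intro bexI)
    let ?D = "\<lbrace>z, x\<rbrace>" and ?D2 = "\<lbrace>z, \<lbrace>z, x\<rbrace>\<rbrace>"
    \<comment> \<open>These are the spectral projections of an operator with
      \<open>D\<^sup>3 = D\<close>.\<close>
    show "(1 / 2) \<odot> (?D2 + ?D) \<in> ?P" "x - ?D2 \<in> ?Z" "(1 / 2) \<odot> (?D2 - ?D) \<in> ?N"
      by (simp_all add: br_simps cubic algebra_simps)
    have "(1 / 2) \<odot> (?D2 + ?D) + (1 / 2) \<odot> (?D2 - ?D) = (1 / 2 + 1 / 2) \<odot> ?D2"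
      unfolding scale_left_distrib by (simp add: algebra_simps)
    then show "x = (1 / 2) \<odot> (?D2 + ?D) + (x - ?D2) + (1 / 2) \<odot> (?D2 - ?D)"
      by (simp add: algebra_simps)
  qed
qed

lemma post_lie_rigid:
  assumes post_lie: "post_lie scale lb br (\<lambda>x y. \<lbrace>\<lbrace>z, x\<rbrace>, y\<rbrace> + l \<odot> \<lbrace>x, y\<rbrace>)"
    and not_sl2: "\<not> iso_sum_sl2 scale br"
  shows "(\<forall>x y. \<lbrace>\<lbrace>z, x\<rbrace>, y\<rbrace> + l \<odot> \<lbrace>x, y\<rbrace> = 0 \<and> lb x y = \<lbrace>x, y\<rbrace>) \<or>
    (\<forall>x y. \<lbrace>\<lbrace>z, x\<rbrace>, y\<rbrace> + l \<odot> \<lbrace>x, y\<rbrace> = - \<lbrace>x, y\<rbrace> \<and> lb x y = - \<lbrace>x, y\<rbrace>)"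
proof -
  note identity = post_lie_identity[OF post_lie]
  have lb: "lb x y = \<lbrace>\<lbrace>z, x\<rbrace>, y\<rbrace> + l \<odot> \<lbrace>x, y\<rbrace> - (\<lbrace>\<lbrace>z, y\<rbrace>, x\<rbrace> + l \<odot> \<lbrace>y, x\<rbrace>) + \<lbrace>x, y\<rbrace>" for x y
    using post_lie by (simp add: post_lie_def)
  from identity show ?thesis
  proof (cases rule: weight_cases)
    case 1
    have "u = v" for u v :: 'v using 1[of u] 1[of v] by simp
    then show ?thesis by blast
  next
    case 2
    then show ?thesis by (simp add: lb)
  next
    case 3
    have "lb x y = - \<lbrace>x, y\<rbrace>" for x y
      using 3 br_anti[of x y] by (simp add: lb br_simps)
    with 3 show ?thesis by simp
  next
    case 4
    then have "2 * l = - 1" by (simp only: eq_neg_iff_add_eq_0)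
    then have l: "l = - 1 / 2" by (simp only: eq_divide_eq_numeral1 mult.commute) simp
    \<comment> \<open>Doubling \<open>z\<close> turns the constant \<open>-1/4\<close> of
      \<open>identity\<close> into \<open>-1\<close>, and eigenvalues \<open>1/2\<close>,
      \<open>-1/2\<close> into \<open>1\<close>, \<open>-1\<close>.\<close>
    have "graded_semisimple scale Basis br {x. \<lbrace>2 \<odot> z, x\<rbrace> = x} {x. \<lbrace>2 \<odot> z, x\<rbrace> = 0}
      {x. \<lbrace>2 \<odot> z, x\<rbrace> = - x}"
    proof (rule graded_of_half_weight)
      show "\<lbrace>\<lbrace>2 \<odot> z, x\<rbrace>, \<lbrace>2 \<odot> z, y\<rbrace>\<rbrace> = \<lbrace>2 \<odot> z, \<lbrace>2 \<odot> z, \<lbrace>x, y\<rbrace>\<rbrace>\<rbrace> - \<lbrace>x, y\<rbrace>" for x y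
      proof -
        have "\<lbrace>\<lbrace>z, x\<rbrace>, \<lbrace>z, y\<rbrace>\<rbrace> = \<lbrace>z, \<lbrace>z, \<lbrace>x, y\<rbrace>\<rbrace>\<rbrace> - (1 / 4) \<odot> \<lbrace>x, y\<rbrace>"
          using identity[of x y] by (simp add: l)
        then show ?thesis by (simp add: br_simps scale_right_diff_distrib)
      qed
    qed
    then have "iso_sum_sl2 scale br" by (rule graded_semisimple.graded_iso_sum_sl2)
    with not_sl2 show ?thesis ..
  qed
qed

end

text \<open>A basis is extracted from the finite spanning set. An abelian ideal is solvable because
  its derived series reaches zero after one step.\<close>

lemma cfd_semisimpleI:
  fixes smul :: "complex \<Rightarrow> 'v::ab_group_add \<Rightarrow> 'v"
  assumes fin: "fin_dim_cvs smul" and semisimple: "semisimple smul nb"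
  obtains Basis where "cfd_semisimple smul Basis nb"
proof -
  interpret vector_space smul using fin by (simp add: fin_dim_cvs_def)
  obtain S where S: "finite S" "span S = UNIV" using fin by (auto simp: fin_dim_cvs_def)
  obtain B where B: "B \<subseteq> S" "independent B" "S \<subseteq> span B"
    using maximal_independent_subset by blast
  have "span B = UNIV" using S(2) B(3) span_mono span_span by blast
  then interpret finite_dimensional_vector_space smul B
    using B finite_subset[OF _ S(1)] by unfold_locales auto
  have lie: "lie_algebra smul nb" using semisimple by (simp add: semisimple_def)
  interpret cfd_lie smul B nb
    by unfold_locales (use lie in \<open>auto simp: lie_algebra_def\<close>)
  have "cfd_semisimple smul B nb"
  proof unfold_locales
    fix I
    assume I: "subspace I" and ideal: "\<And>x y. y \<in> I \<Longrightarrow> nb x y \<in> I"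
      and abelian: "\<And>x y. x \<in> I \<Longrightarrow> y \<in> I \<Longrightarrow> nb x y = 0"
    have "{nb a b | a b. a \<in> I \<and> b \<in> I} = {0}"
      using abelian subspace_0[OF I] by force
    then have "derived_series smul nb I 1 = {0}" by simp
    then have "solvable_ideal smul nb I" unfolding solvable_ideal_def ..
    then show "I \<subseteq> {0}"
      using semisimple I ideal by (auto simp: semisimple_def lie_ideal_def)
  qed
  then show thesis by (rule that)
qed

theorem theorem6p4:
  fixes smul :: "complex \<Rightarrow> 'v::ab_group_add \<Rightarrow> 'v"
    and lb nb :: "'v \<Rightarrow> 'v \<Rightarrow> 'v"
    and z :: 'v and lam :: complex
  assumes "fin_dim_cvs smul"
    and "lie_algebra smul lb"
    and "lie_algebra smul nb"
    and "semisimple smul nb"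
    and "\<not> iso_sum_sl2 smul nb"
    and "post_lie smul lb nb (\<lambda>x y. nb (nb z x) y + smul lam (nb x y))"
  shows "(\<forall>x y. nb (nb z x) y + smul lam (nb x y) = 0 \<and> lb x y = nb x y) \<or>
         (\<forall>x y. nb (nb z x) y + smul lam (nb x y) = - nb x y \<and> lb x y = - nb x y)"
proof -
  obtain B where "cfd_semisimple smul B nb" using assms(1,4) by (rule cfd_semisimpleI)
  then interpret cfd_semisimple smul B nb .
  show ?thesis using assms(6,5) by (rule post_lie_rigid)
qed

end
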